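(* Let $m\geq 2$ be an integer, $\mathbf{p}=(p_1,\ldots,p_m)\in[1,\infty]^m$ with $\left|\frac{1}{\mathbf{p}}\right|\leq\frac12$, and $\mathbf{r}=(r_1,\ldots,r_m)\in[1,2]^m$. Then there is a constant $D^{\mathbb{K}}_{m,\mathbf{r},\mathbf{p}}\geq 1$ (not depending on $n$) such that $$\left(\sum_{i_1=1}^n\left(\cdots\left(\sum_{i_m=1}^n|T(e_{i_1},\ldots,e_{i_m})|^{r_m}\right)^{\frac{r_{m-1}}{r_m}}\cdots\right)^{\frac{r_1}{r_2}}\right)^{\frac{1}{r_1}}\leq D^{\mathbb{K}}_{m,\mathbf{r},\mathbf{p}}\, n^{\max\left\{\left|\frac{1}{\mathbf{r}}\right|-\frac{m+1}{2}+\left|\frac{1}{\mathbf{p}}\right|,\,0\right\}}\,\|T\|$$ for all positive integers $n$ and all $m$-linear forms $T:\ell_{p_1}^n\times\cdots\times\ell_{p_m}^n\to\mathbb{K}$. Moreover, the exponent $\max\left\{\left|\frac{1}{\mathbf{r}}\right|-\frac{m+1}{2}+\left|\frac{1}{\mathbf{p}}\right|,0\right\}$ is optimal, i.e. it cannot be replaced by any smaller exponent, whatever the constant.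
   Context: $\mathbb{K}=\mathbb{R}$ or $\mathbb{C}$. For a positive integer $n$ and $p\in[1,\infty]$, $\ell_p^n$ is $\mathbb{K}^n$ with the $\ell_p$-norm (sup norm if $p=\infty$); $e_j$ denotes the $j$-th canonical unit vector. For a tuple $\mathbf{q}=(q_1,\ldots,q_m)$ of positive extended reals, $\left|\frac{1}{\mathbf{q}}\right|:=\frac{1}{q_1}+\cdots+\frac{1}{q_m}$ (with $1/\infty=0$). $\|T\|=\sup\{|T(x^{(1)},\ldots,x^{(m)})|:\|x^{(j)}\|_{p_j}\le 1\}$. *)

theory Defs
  imports "HOL-Analysis.Analysis"
begin

text \<open>Conventions. Indices are 0-based: vectors of \<open>\<ell>_p^n\<close> are functions
  \<open>nat \<Rightarrow> 'a\<close> vanishing at coordinates \<open>\<ge> n\<close>; an m-tuple of vectors is a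
  function \<open>nat \<Rightarrow> (nat \<Rightarrow> 'a)\<close> whose components \<open>j \<ge> m\<close> are zero.
  Exponents \<open>p j \<in> [1,\<infinity>]\<close> are extended reals.\<close>

definition inv_ext :: "ereal \<Rightarrow> real" where
  "inv_ext q = (if q = \<infinity> then 0 else 1 / real_of_ereal q)"

definition pnorm :: "ereal \<Rightarrow> nat \<Rightarrow> (nat \<Rightarrow> 'a::real_normed_vector) \<Rightarrow> real" where
  "pnorm q n v = (if q = \<infinity> then Max ((\<lambda>i. norm (v i)) ` {..<n})
                  else (\<Sum>i<n. norm (v i) powr real_of_ereal q) powr (1 / real_of_ereal q))"

definition supp_vec :: "nat \<Rightarrow> (nat \<Rightarrow> 'a::zero) \<Rightarrow> bool" where
  "supp_vec n v \<longleftrightarrow> (\<forall>i\<ge>n. v i = 0)"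

definition tuples :: "nat \<Rightarrow> nat \<Rightarrow> (nat \<Rightarrow> nat \<Rightarrow> 'a::zero) set" where
  "tuples n m = {x. (\<forall>j<m. supp_vec n (x j)) \<and> (\<forall>j\<ge>m. \<forall>i. x j i = 0)}"

definition multilinear_form :: "nat \<Rightarrow> nat \<Rightarrow> ((nat \<Rightarrow> nat \<Rightarrow> 'a::real_normed_field) \<Rightarrow> 'a) \<Rightarrow> bool" where
  "multilinear_form n m T \<longleftrightarrow>
     (\<forall>x\<in>tuples n m. \<forall>j<m. \<forall>u v a b. supp_vec n u \<longrightarrow> supp_vec n v \<longrightarrow>
        T (x(j := (\<lambda>i. a * u i + b * v i))) = a * T (x(j := u)) + b * T (x(j := v)))"

definition opnorm :: "nat \<Rightarrow> nat \<Rightarrow> (nat \<Rightarrow> ereal) \<Rightarrow> ((nat \<Rightarrow> nat \<Rightarrow> 'a::real_normed_field) \<Rightarrow> 'a) \<Rightarrow> real" where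
  "opnorm n m p T = Sup {norm (T x) | x. x \<in> tuples n m \<and> (\<forall>j<m. pnorm (p j) n (x j) \<le> 1)}"

definition unit_vec :: "nat \<Rightarrow> nat \<Rightarrow> 'a::real_normed_field" where
  "unit_vec i = (\<lambda>l. if l = i then 1 else 0)"

text \<open>Mixed \<open>\<ell>_r\<close>-sum of the coefficients \<open>T(e_{i_1},\<dots>,e_{i_m})\<close>.
  \<open>mixsum T n m r d idx\<close>: the first \<open>m - d\<close> indices are fixed by \<open>idx\<close>, the last \<open>d\<close>
  are summed, index number \<open>k\<close> (0-based) with exponent \<open>r k\<close>.\<close>
fun mixsum :: "((nat \<Rightarrow> nat \<Rightarrow> 'a::real_normed_field) \<Rightarrow> 'a) \<Rightarrow> nat \<Rightarrow> nat \<Rightarrow> (nat \<Rightarrow> real)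
               \<Rightarrow> nat \<Rightarrow> (nat \<Rightarrow> nat) \<Rightarrow> real" where
  "mixsum T n m r 0 idx = norm (T (\<lambda>j. if j < m then unit_vec (idx j) else (\<lambda>_. 0)))"
| "mixsum T n m r (Suc d) idx =
     (\<Sum>i<n. mixsum T n m r d (idx(m - Suc d := i)) powr r (m - Suc d)) powr (1 / r (m - Suc d))"

definition mixed_norm :: "((nat \<Rightarrow> nat \<Rightarrow> 'a::real_normed_field) \<Rightarrow> 'a) \<Rightarrow> nat \<Rightarrow> nat \<Rightarrow> (nat \<Rightarrow> real) \<Rightarrow> real" where
  "mixed_norm T n m r = mixsum T n m r m (\<lambda>_. 0)"

end

theory Submission
  imports Defs
begin

text \<open>
  Write \<open>t\<^sub>j = 1/p\<^sub>j\<close> and \<open>1/\<lambda> = 1 - \<Sum>\<^sub>j t\<^sub>j \<ge> 1/2\<close>. For every position \<open>k\<close> the coefficients have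
  mixed norm at most \<open>C \<parallel>T\<parallel>\<close> with exponent \<open>\<lambda>\<close> at \<open>k\<close> and \<open>2\<close> elsewhere: Khinchine's inequality
  gives this for forms on \<open>\<ell>\<^sub>\<infinity>\<close> (exponent 1 at \<open>k\<close>), applied to \<open>T(y\<^sup>1x\<^sup>1, \<dots>, y\<^sup>mx\<^sup>m)\<close> with
  weights \<open>y\<^sup>j\<close> in the unit ball of \<open>\<ell>\<^bsub>p\<^sub>j\<^esub>\<close>, and the weights are then removed one at a time by
  Hoelder's inequality and duality. Minkowski's inequality and interpolation between the \<open>m\<close>
  positions yield all exponents \<open>1/q\<^sub>j = 1/2 + \<theta>\<^sub>j (1/\<lambda> - 1/2)\<close> with \<open>\<theta>\<close> a convex weight, and passing from
  \<open>q\<close> to \<open>r\<close> costs \<open>n\<close> to the power \<open>\<Sum>\<^sub>j max(0, 1/r\<^sub>j - 1/q\<^sub>j)\<close>, which is the claimed exponent for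
  suitable \<open>\<theta>\<close>.

  For optimality, a product of first coordinates excludes negative exponents. Otherwise there is a
  form with coefficients \<open>\<plusminus>1\<close> and norm \<open>O(n powr ((m + 1)/2 - \<Sum>\<^sub>j t\<^sub>j) log n)\<close>, of Kahane--Salem--Zygmund type;
  the logarithm is harmless. All random choices of signs are made greedily, by keeping the conditional
  expectation of a potential under control.
\<close>

section \<open>Hoelder, Minkowski and duality for finite sums\<close>

text \<open>Jensen's inequality for \<open>exp\<close> at the points \<open>ln (x k)\<close>. A
  vanishing \<open>x k\<close> is split off first: it kills the product, since
  \<open>0 powr w = 0\<close>.\<close>

lemma weighted_geometric_le_arithmetic:
  fixes x :: "'k \<Rightarrow> real"
  assumes "finite K" "\<And>k. k \<in> K \<Longrightarrow> w k > 0" "(\<Sum>k\<in>K. w k) = 1" "\<And>k. k \<in> K \<Longrightarrow> x k \<ge> 0"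
  shows "(\<Prod>k\<in>K. x k powr w k) \<le> (\<Sum>k\<in>K. w k * x k)"
proof (cases "\<exists>k\<in>K. x k = 0")
  case True
  then have "(\<Prod>k\<in>K. x k powr w k) = 0"
    using assms(1) by auto
  moreover have "0 \<le> (\<Sum>k\<in>K. w k * x k)"
    using assms by (intro sum_nonneg mult_nonneg_nonneg) (auto simp: less_imp_le)
  ultimately show ?thesis by simp
next
  case False
  have pos: "x k > 0" if "k \<in> K" for k
    using False assms(4)[OF that] that by fastforce
  have "(\<Prod>k\<in>K. x k powr w k) = exp (\<Sum>k\<in>K. w k * ln (x k))"
    using False by (auto simp: powr_def exp_sum[OF assms(1)] intro!: prod.cong)
  also have "\<dots> \<le> (\<Sum>k\<in>K. w k * exp (ln (x k)))"
  proof -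
    have "exp (\<Sum>k\<in>K. w k *\<^sub>R ln (x k)) \<le> (\<Sum>k\<in>K. w k * exp (ln (x k)))"
      by (rule convex_on_sum[OF assms(1) _ exp_convex])
        (use assms in \<open>auto simp: less_imp_le\<close>)
    then show ?thesis by simp
  qed
  also have "\<dots> = (\<Sum>k\<in>K. w k * x k)"
    using pos by (intro sum.cong) auto
  finally show ?thesis .
qed

text \<open>Dividing each \<open>f k\<close> by its sum reduces the claim to weighted AM-GM at every
  \<open>i\<close>. The weights \<open>w k\<close> are the reciprocals of the usual Hoelder
  exponents, so any finite number of factors is treated at once.\<close>

lemma Hoelder_prod_sum:
  fixes f :: "'k \<Rightarrow> 'i \<Rightarrow> real"
  assumes K: "finite K" "\<And>k. k \<in> K \<Longrightarrow> w k > 0" "(\<Sum>k\<in>K. w k) = 1"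
    and I: "finite I" "\<And>k i. k \<in> K \<Longrightarrow> i \<in> I \<Longrightarrow> f k i \<ge> 0"
  shows "(\<Sum>i\<in>I. \<Prod>k\<in>K. f k i powr w k) \<le> (\<Prod>k\<in>K. (\<Sum>i\<in>I. f k i) powr w k)"
proof (cases "\<exists>k\<in>K. (\<Sum>i\<in>I. f k i) = 0")
  case True
  then obtain k where k: "k \<in> K" "(\<Sum>i\<in>I. f k i) = 0" by blast
  then have "\<forall>i\<in>I. f k i = 0"
    using I by (simp add: sum_nonneg_eq_0_iff)
  then have "(\<Sum>i\<in>I. \<Prod>k\<in>K. f k i powr w k) = 0"
    using k(1) K(1) by (intro sum.neutral) fastforce
  then show ?thesis by (simp add: prod_nonneg)
next
  case False
  define F where "F k = (\<Sum>i\<in>I. f k i)" for k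
  have F: "F k > 0" if "k \<in> K" for k
    using False that I by (metis F_def order_le_imp_less_or_eq sum_nonneg)
  have "(\<Sum>i\<in>I. \<Prod>k\<in>K. f k i powr w k)
      = (\<Sum>i\<in>I. (\<Prod>k\<in>K. F k powr w k) * (\<Prod>k\<in>K. (f k i / F k) powr w k))"
    unfolding prod.distrib[symmetric]
  proof (intro sum.cong prod.cong refl)
    fix i k assume "i \<in> I" "k \<in> K"
    then show "f k i powr w k = F k powr w k * (f k i / F k) powr w k"
      using F[of k] I(2)[of k i] by (simp flip: powr_mult)
  qed
  also have "\<dots> \<le> (\<Sum>i\<in>I. (\<Prod>k\<in>K. F k powr w k) * (\<Sum>k\<in>K. w k * (f k i / F k)))"
    using F I(2) K
    by (intro sum_mono mult_left_mono weighted_geometric_le_arithmetic prod_nonneg)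
      (auto simp: less_imp_le)
  also have "\<dots> = (\<Prod>k\<in>K. F k powr w k) * (\<Sum>k\<in>K. w k * (\<Sum>i\<in>I. f k i) / F k)"
    unfolding sum_distrib_left[symmetric]
    by (subst sum.swap) (simp add: sum_distrib_left sum_divide_distrib)
  also have "(\<Sum>k\<in>K. w k * (\<Sum>i\<in>I. f k i) / F k) = (\<Sum>k\<in>K. w k)"
    using F by (intro sum.cong) (force simp: F_def)+
  finally show ?thesis
    using K by (simp add: F_def)
qed

lemma Hoelder_two_sum:
  fixes f g :: "'i \<Rightarrow> real"
  assumes u: "0 < u" "u < 1" and I: "finite I" "\<And>i. i \<in> I \<Longrightarrow> f i \<ge> 0" "\<And>i. i \<in> I \<Longrightarrow> g i \<ge> 0"
  shows "(\<Sum>i\<in>I. f i powr u * g i powr (1 - u))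
    \<le> (\<Sum>i\<in>I. f i) powr u * (\<Sum>i\<in>I. g i) powr (1 - u)"
  using Hoelder_prod_sum[of "UNIV :: bool set" "\<lambda>b. if b then u else 1 - u" I "\<lambda>b. if b then f else g"] assms
  by (simp add: UNIV_bool mult.commute)

text \<open>This is the triangle inequality in the space with exponent \<open>1 / u\<close>, for the
  vectors with entries \<open>g i j powr u\<close> indexed by \<open>j\<close>. One factor
  \<open>A j\<close> is split off \<open>A j powr (1 / u)\<close>, Hoelder with weights
  \<open>u\<close> and \<open>1 - u\<close> is applied for each \<open>i\<close>, and
  \<open>S powr (1 - u)\<close> is cancelled.\<close>

lemma Minkowski_powr_sum:
  fixes g :: "'i \<Rightarrow> 'j \<Rightarrow> real"
  assumes u: "0 < u" "u \<le> 1" and fin: "finite I" "finite J"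
    and g: "\<And>i j. i \<in> I \<Longrightarrow> j \<in> J \<Longrightarrow> g i j \<ge> 0"
  shows "(\<Sum>j\<in>J. (\<Sum>i\<in>I. g i j powr u) powr (1 / u)) powr u \<le> (\<Sum>i\<in>I. (\<Sum>j\<in>J. g i j) powr u)"
proof (cases "u = 1")
  case True
  have "(\<Sum>j\<in>J. \<Sum>i\<in>I. g i j) = (\<Sum>i\<in>I. \<Sum>j\<in>J. g i j)" by (rule sum.swap)
  then show ?thesis using True g by (simp add: sum_nonneg)
next
  case False
  then have u1: "u < 1" using u by simp
  define A where "A j = (\<Sum>i\<in>I. g i j powr u)" for j
  define S where "S = (\<Sum>j\<in>J. A j powr (1 / u))"
  have A0: "A j \<ge> 0" for j unfolding A_def by (simp add: sum_nonneg)
  have S0: "S \<ge> 0" unfolding S_def by (simp add: sum_nonneg)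
  show ?thesis
  proof (cases "S = 0")
    case True
    then show ?thesis by (simp add: S_def A_def sum_nonneg)
  next
    case False
    then have Spos: "S > 0" using S0 by simp
    have "S = (\<Sum>j\<in>J. \<Sum>i\<in>I. g i j powr u * (A j powr (1 / u)) powr (1 - u))"
      unfolding S_def
    proof (intro sum.cong refl)
      fix j
      have "A j powr (1 / u) = A j * A j powr ((1 - u) / u)"
      proof (cases "A j = 0")
        case False
        then have "A j powr (1 / u) = A j powr (1 + (1 - u) / u)"
          using u by (simp add: field_simps)
        then show ?thesis using False A0[of j] by (simp add: powr_add)
      qed simp
      moreover have "(A j powr (1 / u)) powr (1 - u) = A j powr ((1 - u) / u)"
        by (simp add: powr_powr)
      ultimately show "A j powr (1 / u) = (\<Sum>i\<in>I. g i j powr u * (A j powr (1 / u)) powr (1 - u))"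
        by (simp only: A_def[symmetric] sum_distrib_right[symmetric])
    qed
    also have "\<dots> = (\<Sum>i\<in>I. \<Sum>j\<in>J. g i j powr u * (A j powr (1 / u)) powr (1 - u))"
      by (rule sum.swap)
    also have "\<dots> \<le> (\<Sum>i\<in>I. (\<Sum>j\<in>J. g i j) powr u * S powr (1 - u))"
      unfolding S_def using u u1 fin g by (intro sum_mono Hoelder_two_sum) auto
    finally have le: "S \<le> (\<Sum>i\<in>I. (\<Sum>j\<in>J. g i j) powr u) * S powr (1 - u)"
      by (simp add: sum_distrib_right)
    have "S = S powr u * S powr (1 - u)"
      using Spos by (simp flip: powr_add)
    with le have "S powr u * S powr (1 - u) \<le> (\<Sum>i\<in>I. (\<Sum>j\<in>J. g i j) powr u) * S powr (1 - u)"
      by simp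
    then show ?thesis
      using Spos by (simp add: S_def A_def)
  qed
qed

section \<open>Duality with weights and raising the exponent\<close>

text \<open>The parameter is \<open>t = 1 / p\<close>, with \<open>t = 0\<close> for the sup norm,
  because the reciprocals are what adds up. The outer root of the norm is left out, as it does not
  affect being at most 1.\<close>

definition unit_ball :: "real \<Rightarrow> nat \<Rightarrow> (nat \<Rightarrow> 'a::real_normed_vector) \<Rightarrow> bool" where
  "unit_ball t n y \<longleftrightarrow>
     (if t = 0 then \<forall>i<n. norm (y i) \<le> 1 else (\<Sum>i<n. norm (y i) powr (1 / t)) \<le> 1)"

text \<open>Put \<open>\<kappa> = l / lz\<close>. For nonnegative \<open>y\<close> in the unit ball,
  \<open>y powr lz\<close> lies in the unit ball of exponent \<open>1 / (t * lz)\<close>, which is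
  conjugate to \<open>\<kappa>\<close> because \<open>t * lz = 1 - 1 / \<kappa>\<close>. Hence the
  hypothesis tests \<open>\<beta>\<close> against the dual ball.\<close>

lemma duality_powr_sum:
  fixes \<beta> :: "nat \<Rightarrow> real"
  assumes t: "t > 0" and lz: "lz > 0" and l: "1 / l = 1 / lz - t" "l > 0"
    and \<beta>: "\<And>j. \<beta> j \<ge> 0" and W: "W \<ge> 0"
    and *: "\<And>y :: nat \<Rightarrow> real. (\<And>j. y j \<ge> 0) \<Longrightarrow> unit_ball t n y \<Longrightarrow> (\<Sum>j<n. y j powr lz * \<beta> j) \<le> W"
  shows "(\<Sum>j<n. \<beta> j powr (l / lz)) \<le> W powr (l / lz)"
proof -
  define \<kappa> where "\<kappa> = l / lz"
  define Z where "Z = (\<Sum>j<n. \<beta> j powr \<kappa>)"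
  have k: "\<kappa> > 0" using lz l by (simp add: \<kappa>_def)
  have tl: "t * lz = 1 - 1 / \<kappa>"
  proof -
    have "t = 1 / lz - 1 / l" using l(1) by simp
    then show ?thesis using lz l(2) by (simp add: \<kappa>_def field_simps)
  qed
  have Z0: "Z \<ge> 0" unfolding Z_def by (simp add: sum_nonneg)
  show ?thesis
  proof (cases "Z = 0")
    case True
    then show ?thesis by (simp add: Z_def \<kappa>_def)
  next
    case False
    then have Z: "Z > 0" using Z0 by simp
    \<comment> \<open>The extremal vector for Hoelder's inequality, normalised to lie on the unit
      sphere.\<close>
    define y where "y j = (\<beta> j powr \<kappa> / Z) powr t" for j
    have ub: "unit_ball t n y"
    proof -
      have "(\<Sum>j<n. norm (y j) powr (1 / t)) = (\<Sum>j<n. \<beta> j powr \<kappa> / Z)"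
        using t Z by (intro sum.cong) (auto simp: y_def powr_powr)
      also have "\<dots> = 1" using Z by (simp add: Z_def flip: sum_divide_distrib)
      finally show ?thesis using t by (simp add: unit_ball_def)
    qed
    have "(\<Sum>j<n. y j powr lz * \<beta> j) \<le> W"
      by (intro * ub) (simp add: y_def)
    moreover have "y j powr lz * \<beta> j = \<beta> j powr \<kappa> * Z powr (1 / \<kappa> - 1)" for j
    proof (cases "\<beta> j = 0")
      case False
      then have b: "\<beta> j > 0" using \<beta>[of j] by simp
      have "y j powr lz = (\<beta> j powr \<kappa> / Z) powr (1 - 1 / \<kappa>)"
        by (simp add: y_def powr_powr tl)
      also have "\<dots> = \<beta> j powr (\<kappa> * (1 - 1 / \<kappa>)) * Z powr (1 / \<kappa> - 1)"
        using b Z powr_minus_divide[of Z "1 - 1 / \<kappa>"]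
        by (simp add: powr_divide powr_powr)
      also have "\<kappa> * (1 - 1 / \<kappa>) = \<kappa> - 1" using k by (simp add: field_simps)
      finally have "y j powr lz * \<beta> j = (\<beta> j powr (\<kappa> - 1) * \<beta> j powr 1) * Z powr (1 / \<kappa> - 1)"
        using b by simp
      also have "\<beta> j powr (\<kappa> - 1) * \<beta> j powr 1 = \<beta> j powr \<kappa>"
        by (subst powr_add[symmetric]) simp
      finally show ?thesis .
    qed (simp add: y_def)
    ultimately have "Z * Z powr (1 / \<kappa> - 1) \<le> W"
      by (simp add: Z_def flip: sum_distrib_right)
    then have "Z powr 1 * Z powr (1 / \<kappa> - 1) \<le> W"
      using Z by simp
    then have "Z powr (1 / \<kappa>) \<le> W"
      by (subst (asm) powr_add[symmetric]) simp
    then have "(Z powr (1 / \<kappa>)) powr \<kappa> \<le> W powr \<kappa>"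
      using k by (intro powr_mono2) auto
    then show ?thesis using k Z by (simp add: powr_powr flip: Z_def \<kappa>_def)
  qed
qed

text \<open>By duality, \<open>col\<close> controls the column sums \<open>B\<close>, and
  \<open>row\<close> controls an auxiliary vector \<open>\<beta>\<close>; the row sums follow by
  interpolating between the two. For \<open>l = 2\<close> the exponent \<open>l / 2\<close> is 1,
  and summing by rows or by columns gives the same value.\<close>

lemma Hardy_Littlewood_step:
  fixes A :: "nat \<Rightarrow> nat \<Rightarrow> real"
  assumes t: "t > 0" and lz: "lz \<ge> 1" and l: "1 / l = 1 / lz - t" "0 < l" "l \<le> 2"
    and A: "\<And>i j. A i j \<ge> 0" and M: "M \<ge> 0"
    and row: "\<And>y :: nat \<Rightarrow> real. (\<And>j. y j \<ge> 0) \<Longrightarrow> unit_ball t n y \<Longrightarrow>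
       (\<Sum>i<n. (\<Sum>j<n. A i j * (y j)\<^sup>2) powr (lz / 2)) \<le> M powr lz"
    and col: "\<And>y :: nat \<Rightarrow> real. (\<And>j. y j \<ge> 0) \<Longrightarrow> unit_ball t n y \<Longrightarrow>
       (\<Sum>j<n. y j powr lz * (\<Sum>i<n. A i j) powr (lz / 2)) \<le> M powr lz"
  shows "(\<Sum>i<n. (\<Sum>j<n. A i j) powr (l / 2)) \<le> M powr l"
proof -
  define B where "B j = (\<Sum>i<n. A i j)" for j
  have B0: "B j \<ge> 0" for j by (simp add: B_def sum_nonneg A)
  have Bsum: "(\<Sum>j<n. B j powr (l / 2)) \<le> M powr l"
  proof -
    have "(\<Sum>j<n. (B j powr (lz / 2)) powr (l / lz)) \<le> (M powr lz) powr (l / lz)"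
      using t lz l col by (intro duality_powr_sum[where t = t]) (auto simp: B_def)
    then show ?thesis using lz by (simp add: powr_powr)
  qed
  show ?thesis
  proof (cases "l = 2")
    case True
    have "(\<Sum>i<n. \<Sum>j<n. A i j) = (\<Sum>j<n. B j)"
      unfolding B_def by (rule sum.swap)
    then show ?thesis using Bsum True B0 by (simp add: sum_nonneg A)
  next
    case False
    then have l2: "l < 2" using l by simp
    have "1 / l < 1 / lz" using l t by simp
    then have ll: "lz < l" using lz l(2) by (simp add: field_simps)
    \<comment> \<open>Chosen so that \<open>T i powr ((l - 2) / 2)\<close> is the
      \<open>\<theta>\<close>-th power of \<open>T i powr ((lz - 2) / 2)\<close>, the factor that
      the row hypothesis can handle.\<close>
    define \<theta> where "\<theta> = (2 - l) / (2 - lz)"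
    have th: "0 < \<theta>" "\<theta> < 1" using l2 ll by (auto simp: \<theta>_def)
    have th2: "(lz - 2) * \<theta> = l - 2" using l2 ll by (simp add: \<theta>_def field_simps)
    define T where "T i = (\<Sum>j<n. A i j)" for i
    have T0: "T i \<ge> 0" for i by (simp add: T_def sum_nonneg A)
    \<comment> \<open>If \<open>T i = 0\<close>, then the negative power has the value 0, and all
      \<open>A i j\<close> vanish as well. Paired with \<open>y j powr lz\<close>, this vector is
      dominated by the left side of \<open>row\<close>, by Hoelder over \<open>j\<close>.\<close>
    define \<beta> where "\<beta> j = (\<Sum>i<n. A i j * T i powr ((lz - 2) / 2))" for j
    have b0: "\<beta> j \<ge> 0" for j by (simp add: \<beta>_def sum_nonneg A)
    have bsum: "(\<Sum>j<n. \<beta> j powr (l / lz)) \<le> M powr l"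
    proof -
      have "(\<Sum>j<n. \<beta> j powr (l / lz)) \<le> (M powr lz) powr (l / lz)"
      proof (rule duality_powr_sum[where t = t])
        fix y :: "nat \<Rightarrow> real" assume y: "\<And>j. y j \<ge> 0" "unit_ball t n y"
        have "(\<Sum>j<n. y j powr lz * \<beta> j)
            = (\<Sum>i<n. T i powr ((lz - 2) / 2) * (\<Sum>j<n. y j powr lz * A i j))"
          unfolding \<beta>_def sum_distrib_left by (subst sum.swap) (simp add: mult_ac)
        also have "\<dots> \<le> (\<Sum>i<n. (\<Sum>j<n. A i j * (y j)\<^sup>2) powr (lz / 2))"
        proof (rule sum_mono)
          fix i
          have "(\<Sum>j<n. y j powr lz * A i j)
             = (\<Sum>j<n. (A i j * (y j)\<^sup>2) powr (lz / 2) * A i j powr (1 - lz / 2))"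
          proof (rule sum.cong[OF refl])
            fix j
            have "(y j)\<^sup>2 powr (lz / 2) = y j powr lz"
              using y(1)[of j] by (simp add: powr_powr flip: powr_numeral)
            moreover have "A i j powr (lz / 2) * A i j powr (1 - lz / 2) = A i j"
              using A[of i j] by (cases "A i j = 0") (auto simp flip: powr_add)
            ultimately show "y j powr lz * A i j
                = (A i j * (y j)\<^sup>2) powr (lz / 2) * A i j powr (1 - lz / 2)"
              using A[of i j] by (simp add: powr_mult mult_ac)
          qed
          also have "\<dots> \<le> (\<Sum>j<n. A i j * (y j)\<^sup>2) powr (lz / 2) * T i powr (1 - lz / 2)"
            unfolding T_def using lz ll l2 A
            by (intro Hoelder_two_sum) (auto intro!: mult_nonneg_nonneg)
          finally have "T i powr ((lz - 2) / 2) * (\<Sum>j<n. y j powr lz * A i j)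
             \<le> T i powr ((lz - 2) / 2) * ((\<Sum>j<n. A i j * (y j)\<^sup>2) powr (lz / 2) * T i powr (1 - lz / 2))"
            by (rule mult_left_mono) simp
          also have "\<dots> = (\<Sum>j<n. A i j * (y j)\<^sup>2) powr (lz / 2)
                * (T i powr ((lz - 2) / 2) * T i powr (1 - lz / 2))"
            by simp
          also have "T i powr ((lz - 2) / 2) * T i powr (1 - lz / 2) = T i powr 0"
            unfolding powr_add[symmetric] by (simp add: field_simps)
          \<comment> \<open>Only an inequality, since \<open>0 powr 0 = 0\<close>.\<close>
          also have "(\<Sum>j<n. A i j * (y j)\<^sup>2) powr (lz / 2) * T i powr 0
             \<le> (\<Sum>j<n. A i j * (y j)\<^sup>2) powr (lz / 2)"
            by simp
          finally show "T i powr ((lz - 2) / 2) * (\<Sum>j<n. y j powr lz * A i j)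
             \<le> (\<Sum>j<n. A i j * (y j)\<^sup>2) powr (lz / 2)" .
        qed
        also have "\<dots> \<le> M powr lz" using row y by blast
        finally show "(\<Sum>j<n. y j powr lz * \<beta> j) \<le> M powr lz" .
      qed (use t lz l b0 in auto)
      then show ?thesis using lz by (simp add: powr_powr)
    qed
    have "(\<Sum>i<n. T i powr (l / 2)) = (\<Sum>i<n. \<Sum>j<n. A i j * T i powr ((l - 2) / 2))"
    proof (rule sum.cong[OF refl])
      fix i
      have "T i powr (l / 2) = T i * T i powr ((l - 2) / 2)"
      proof (cases "T i = 0")
        case False
        then have "T i * T i powr ((l - 2) / 2) = T i powr (1 + (l - 2) / 2)"
          using T0[of i] by (simp only: powr_add) simp
        then show ?thesis by (simp add: field_simps)
      qed simp
      then show "T i powr (l / 2) = (\<Sum>j<n. A i j * T i powr ((l - 2) / 2))"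
        by (simp add: T_def sum_distrib_right)
    qed
    also have "\<dots> = (\<Sum>j<n. \<Sum>i<n. (A i j * T i powr ((lz - 2) / 2)) powr \<theta> * A i j powr (1 - \<theta>))"
    proof (subst sum.swap, intro sum.cong refl)
      fix i j
      have "A i j powr \<theta> * A i j powr (1 - \<theta>) = A i j"
        using A[of i j] by (cases "A i j = 0") (auto simp flip: powr_add)
      moreover have "(T i powr ((lz - 2) / 2)) powr \<theta> = T i powr ((l - 2) / 2)"
        using th2 by (simp add: powr_powr)
      ultimately show "A i j * T i powr ((l - 2) / 2)
          = (A i j * T i powr ((lz - 2) / 2)) powr \<theta> * A i j powr (1 - \<theta>)"
        using A[of i j] by (simp add: powr_mult mult_ac)
    qed
    \<comment> \<open>Hoelder over \<open>i\<close> for fixed \<open>j\<close>. A second use, over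
      \<open>j\<close> with weight \<open>lz * \<theta> / l\<close>, then produces exactly the two
      sums bounded in \<open>bsum\<close> and \<open>Bsum\<close>.\<close>
    also have "\<dots> \<le> (\<Sum>j<n. \<beta> j powr \<theta> * B j powr (1 - \<theta>))"
      unfolding \<beta>_def B_def using th A by (intro sum_mono Hoelder_two_sum) auto
    also have "\<dots> = (\<Sum>j<n. (\<beta> j powr (l / lz)) powr (lz * \<theta> / l) * (B j powr (l / 2)) powr (1 - lz * \<theta> / l))"
    proof -
      have "lz * \<theta> = l - 2 + 2 * \<theta>" using th2 by (simp add: algebra_simps)
      then have "l / 2 * (1 - lz * \<theta> / l) = 1 - \<theta>"
        using l(2) by (simp add: diff_divide_distrib right_diff_distrib add_divide_distrib)
      moreover have "l / lz * (lz * \<theta> / l) = \<theta>" using l lz by simp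
      ultimately show ?thesis by (simp only: powr_powr)
    qed
    also have "\<dots> \<le> (\<Sum>j<n. \<beta> j powr (l / lz)) powr (lz * \<theta> / l) * (\<Sum>j<n. B j powr (l / 2)) powr (1 - lz * \<theta> / l)"
    proof (rule Hoelder_two_sum)
      show "0 < lz * \<theta> / l" using lz l th by simp
      have "lz * \<theta> < l * 1" using ll th lz by (intro mult_strict_mono) auto
      then show "lz * \<theta> / l < 1" using l(2) by simp
      then have "0 < 1 - lz * \<theta> / l" by simp
    qed auto
    also have "\<dots> \<le> (M powr l) powr (lz * \<theta> / l) * (M powr l) powr (1 - lz * \<theta> / l)"
    proof -
      have "lz * \<theta> < l * 1" using ll th lz by (intro mult_strict_mono) auto
      then have "lz * \<theta> / l < 1" using l(2) by simp
      then show ?thesis using bsum Bsum lz l th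
        by (intro mult_mono powr_mono2) (auto intro!: sum_nonneg)
    qed
    also have "\<dots> = M powr l"
      by (cases "M = 0") (auto simp flip: powr_add)
    finally show ?thesis by (simp add: T_def)
  qed
qed

section \<open>Mixed norms of arrays\<close>

text \<open>Like \<open>mixsum\<close>, this keeps \<open>idx\<close> as a full index function and
  overwrites the coordinates in \<open>J\<close>, so partial sums nest. \<open>PiE\<close> ensures
  that each choice of those coordinates is counted once.\<close>

definition msum :: "nat \<Rightarrow> nat set \<Rightarrow> ((nat \<Rightarrow> nat) \<Rightarrow> 'a::comm_monoid_add) \<Rightarrow> (nat \<Rightarrow> nat) \<Rightarrow> 'a" where
  "msum n J f idx = (\<Sum>g \<in> PiE J (\<lambda>_. {..<n}). f (\<lambda>j. if j \<in> J then g j else idx j))"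

lemma msum_empty [simp]: "msum n {} f idx = f idx"
  by (simp add: msum_def)

lemma msum_insert:
  assumes "j \<notin> J" "finite J"
  shows "msum n (insert j J) f idx = (\<Sum>i<n. msum n J f (idx(j := i)))"
proof -
  have "msum n (insert j J) f idx
      = (\<Sum>(i, g)\<in>{..<n} \<times> PiE J (\<lambda>_. {..<n}).
           f (\<lambda>l. if l \<in> insert j J then (g(j := i)) l else idx l))"
    unfolding msum_def PiE_insert_eq
    by (subst sum.reindex[OF inj_combinator[OF assms(1)]]) (simp add: case_prod_unfold)
  also have "\<dots> = (\<Sum>(i, g)\<in>{..<n} \<times> PiE J (\<lambda>_. {..<n}).
           f (\<lambda>l. if l \<in> J then g l else (idx(j := i)) l))"
    using assms(1) by (intro sum.cong refl) (auto intro!: arg_cong[of _ _ f])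
  also have "\<dots> = (\<Sum>i<n. msum n J f (idx(j := i)))"
    by (simp add: msum_def sum.cartesian_product)
  finally show ?thesis .
qed

lemma msum_remove:
  assumes "j \<in> J" "finite J"
  shows "msum n J f idx = (\<Sum>i<n. msum n (J - {j}) f (idx(j := i)))"
  using msum_insert[of j "J - {j}" n f idx] assms by (simp add: insert_absorb)

lemma msum_cong:
  assumes "\<And>h. (\<And>l. l \<notin> J \<Longrightarrow> h l = idx l) \<Longrightarrow> (\<And>l. l \<in> J \<Longrightarrow> h l < n) \<Longrightarrow> f h = g h"
  shows "msum n J f idx = msum n J g idx"
  unfolding msum_def by (intro sum.cong refl assms) (auto simp: PiE_iff)

lemma msum_nonneg: "(\<And>h. f h \<ge> (0::real)) \<Longrightarrow> msum n J f idx \<ge> 0"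
  by (simp add: msum_def sum_nonneg)

lemma msum_sum: "msum n J (\<lambda>h. \<Sum>i\<in>I. f i h) idx = (\<Sum>i\<in>I. msum n J (f i) idx)"
  unfolding msum_def by (rule sum.swap)

lemma msum_distrib_left:
  "msum n J (\<lambda>h. (c::'a::semiring_0) * f h) idx = c * msum n J f idx"
  by (simp add: msum_def sum_distrib_left)

text \<open>The weights \<open>y j\<close> are removed one coordinate at a time; removing \<open>y l\<close> moves the outer
  exponent from \<open>1 / lam l\<close> to \<open>1 / lam (Suc l)\<close>.\<close>

lemma Hardy_Littlewood_mixed_two:
  fixes b :: "(nat \<Rightarrow> nat) \<Rightarrow> real" and t :: "nat \<Rightarrow> real"
  assumes t: "\<And>j. j < m \<Longrightarrow> 0 \<le> t j" and ts: "(\<Sum>j<m. t j) \<le> 1 / 2"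
    and M: "M \<ge> 0"
    and hyp: "\<And>y k. (\<And>j i. y j i \<ge> (0::real)) \<Longrightarrow> (\<And>j. j < m \<Longrightarrow> unit_ball (t j) n (y j)) \<Longrightarrow> k < m \<Longrightarrow>
       (\<Sum>i<n. sqrt (msum n ({..<m} - {k}) (\<lambda>h. (b h)\<^sup>2 * (\<Prod>j<m. (y j (h j))\<^sup>2)) (idx(k := i)))) \<le> M"
    and k: "k < m"
  defines "lam \<equiv> \<lambda>l. 1 / (1 - (\<Sum>j<l. t j))"
  shows "(\<Sum>i<n. (msum n ({..<m} - {k}) (\<lambda>h. (b h)\<^sup>2) (idx(k := i))) powr (lam m / 2)) \<le> M powr lam m"
proof -
  have part: "0 \<le> (\<Sum>j<l. t j)" "(\<Sum>j<l. t j) \<le> 1 / 2" if "l \<le> m" for l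
  proof -
    show "0 \<le> (\<Sum>j<l. t j)" using that t by (intro sum_nonneg) auto
    have "(\<Sum>j<l. t j) \<le> (\<Sum>j<m. t j)" using that t by (intro sum_mono2) auto
    then show "(\<Sum>j<l. t j) \<le> 1 / 2" using ts by simp
  qed
  have lam: "1 \<le> lam l" "lam l \<le> 2" "1 / lam l = 1 - (\<Sum>j<l. t j)" if "l \<le> m" for l
    using part[OF that] by (auto simp: lam_def field_simps)
  \<comment> \<open>The product starts at \<open>l\<close>: the weights of the coordinates below
    \<open>l\<close> have already been removed.\<close>
  define S where "S l y k i = msum n ({..<m} - {k}) (\<lambda>h. (b h)\<^sup>2 * (\<Prod>j\<in>{l..<m}. (y j (h j))\<^sup>2)) (idx(k := i))"
    for l y k i
  have S0: "S l y k i \<ge> 0" for l y k i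
    unfolding S_def by (intro msum_nonneg mult_nonneg_nonneg prod_nonneg) auto
  \<comment> \<open>The induction runs over all \<open>y\<close> and \<open>k\<close>
    simultaneously, since removing the weight \<open>l\<close> at a position \<open>k\<close> also
    uses the bound at position \<open>l\<close>.\<close>
  have "(\<Sum>i<n. S l y k i powr (lam l / 2)) \<le> M powr lam l"
    if "l \<le> m" "\<And>j i. y j i \<ge> (0::real)" "\<And>j. l \<le> j \<Longrightarrow> j < m \<Longrightarrow> unit_ball (t j) n (y j)" "k < m" for l y k
    using that
  proof (induction l arbitrary: y k)
    case 0
    have "lam 0 = 1" by (simp add: lam_def)
    moreover have "(\<Sum>i<n. sqrt (S 0 y k i)) \<le> M"
      using hyp[of y k] 0 by (simp add: S_def lessThan_atLeast0)
    ultimately show ?case using M S0 by (simp add: powr_half_sqrt)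
  next
    case (Suc l)
    then have l: "l < m" by simp
    have upd: "(\<Sum>i<n. S l (y(l := z)) k i powr (lam l / 2)) \<le> M powr lam l"
      if "\<And>i. z i \<ge> 0" "unit_ball (t l) n z" "k < m" for z k
      using that Suc.prems l by (intro Suc.IH) (auto simp: le_Suc_eq)
    have split: "(\<Prod>j\<in>{l..<m}. ((y(l := z)) j (h j))\<^sup>2) = (z (h l))\<^sup>2 * (\<Prod>j\<in>{Suc l..<m}. (y j (h j))\<^sup>2)" for z h
    proof -
      have "(\<Prod>j\<in>{l..<m}. ((y(l := z)) j (h j))\<^sup>2)
         = ((y(l := z)) l (h l))\<^sup>2 * (\<Prod>j\<in>{Suc l..<m}. ((y(l := z)) j (h j))\<^sup>2)"
        using l by (rule prod.atLeast_Suc_lessThan)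
      also have "(\<Prod>j\<in>{Suc l..<m}. ((y(l := z)) j (h j))\<^sup>2) = (\<Prod>j\<in>{Suc l..<m}. (y j (h j))\<^sup>2)"
        by (intro prod.cong) auto
      finally show ?thesis by simp
    qed
    show ?case
    \<comment> \<open>For the sup norm the constant weight 1 is admissible and the exponent does not
      change.\<close>
    proof (cases "t l = 0")
      case True
      then have "lam (Suc l) = lam l" by (simp add: lam_def)
      moreover have "(\<Sum>i<n. S l (y(l := (\<lambda>_. 1))) k i powr (lam l / 2)) \<le> M powr lam l"
        using True Suc.prems by (intro upd) (auto simp: unit_ball_def)
      moreover have "S l (y(l := (\<lambda>_. 1))) k i = S (Suc l) y k i" for i
        unfolding S_def split by simp
      ultimately show ?thesis by simp
    next
      case False
      then have tl: "t l > 0" using t[OF l] by simp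
      have l1: "1 / lam (Suc l) = 1 / lam l - t l" using lam(3)[of l] lam(3)[of "Suc l"] l by simp
      \<comment> \<open>At the outer position \<open>l\<close> the new weight depends on the outer
        index alone, so it leaves the inner sum as a factor.\<close>
      have col: "(\<Sum>i<n. z i powr lam l * S (Suc l) y l i powr (lam l / 2)) \<le> M powr lam l"
        if z: "\<And>i. z i \<ge> 0" "unit_ball (t l) n z" for z
      proof -
        have S_l: "S l (y(l := z)) l i = (z i)\<^sup>2 * S (Suc l) y l i" for i
          unfolding S_def split msum_distrib_left[symmetric]
          by (rule msum_cong) simp
        have "S l (y(l := z)) l i powr (lam l / 2) = z i powr lam l * S (Suc l) y l i powr (lam l / 2)" for i
        proof -
          have "(z i)\<^sup>2 powr (lam l / 2) = z i powr lam l"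
            using z(1)[of i] by (simp add: powr_powr flip: powr_numeral)
          then show ?thesis using S0 by (simp add: S_l powr_mult)
        qed
        then show ?thesis using upd[OF z l] by simp
      qed
      show ?thesis
      proof (cases "k = l")
        case True
        \<comment> \<open>Here the outer position carries the weight itself, and duality alone
          raises the exponent.\<close>
        have "(\<Sum>i<n. (S (Suc l) y l i powr (lam l / 2)) powr (lam (Suc l) / lam l))
            \<le> (M powr lam l) powr (lam (Suc l) / lam l)"
          using tl lam(1)[of l] lam(1)[of "Suc l"] l l1 col
          by (intro duality_powr_sum[where t = "t l"]) auto
        then show ?thesis using True lam(1)[of l] l by (simp add: powr_powr)
      next
        case False
        \<comment> \<open>All coordinates except \<open>k\<close> and \<open>l\<close> are summed.
          The row sums of this matrix belong to the outer position \<open>k\<close>, the column sums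
          to the outer position \<open>l\<close>.\<close>
        define A where "A i j = msum n ({..<m} - {k} - {l})
            (\<lambda>h. (b h)\<^sup>2 * (\<Prod>j\<in>{Suc l..<m}. (y j (h j))\<^sup>2)) (idx(k := i, l := j))" for i j
        have A0: "A i j \<ge> 0" for i j
          unfolding A_def by (intro msum_nonneg mult_nonneg_nonneg prod_nonneg) auto
        have row_eq: "S (Suc l) y k i = (\<Sum>j<n. A i j)" for i
          unfolding S_def A_def using False l by (intro msum_remove) auto
        have col_eq: "S (Suc l) y l j = (\<Sum>i<n. A i j)" for j
        proof -
          have "S (Suc l) y l j = (\<Sum>i<n. msum n ({..<m} - {l} - {k})
            (\<lambda>h. (b h)\<^sup>2 * (\<Prod>j\<in>{Suc l..<m}. (y j (h j))\<^sup>2)) (idx(l := j, k := i)))"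
            unfolding S_def using False Suc.prems by (intro msum_remove) auto
          moreover have "{..<m} - {l} - {k} = {..<m} - {k} - {l}" by auto
          ultimately show ?thesis using False by (simp add: A_def fun_upd_twist)
        qed
        have wrow_eq: "S l (y(l := z)) k i = (\<Sum>j<n. A i j * (z j)\<^sup>2)" for z i
        proof -
          have "S l (y(l := z)) k i = (\<Sum>j<n. msum n ({..<m} - {k} - {l})
            (\<lambda>h. (z (h l))\<^sup>2 * ((b h)\<^sup>2 * (\<Prod>j\<in>{Suc l..<m}. (y j (h j))\<^sup>2))) (idx(k := i, l := j)))"
            unfolding S_def split using False l
            by (subst msum_remove[of l]) (auto simp: mult_ac)
          also have "\<dots> = (\<Sum>j<n. (z j)\<^sup>2 * A i j)"
            unfolding A_def msum_distrib_left[symmetric]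
            by (intro sum.cong refl msum_cong) simp
          finally show ?thesis by (simp add: mult.commute)
        qed
        have "(\<Sum>i<n. (\<Sum>j<n. A i j) powr (lam (Suc l) / 2)) \<le> M powr lam (Suc l)"
        proof (rule Hardy_Littlewood_step[where t = "t l" and lz = "lam l"])
          show "(\<Sum>i<n. (\<Sum>j<n. A i j * (z j)\<^sup>2) powr (lam l / 2)) \<le> M powr lam l"
            if "\<And>j. z j \<ge> 0" "unit_ball (t l) n z" for z
            using upd[OF that \<open>k < m\<close>] by (simp add: wrow_eq)
          show "(\<Sum>j<n. z j powr lam l * (\<Sum>i<n. A i j) powr (lam l / 2)) \<le> M powr lam l"
            if "\<And>j. z j \<ge> 0" "unit_ball (t l) n z" for z
            using col[OF that] by (simp add: col_eq)
        qed (use tl lam[of l] lam[of "Suc l"] l l1 A0 M in auto)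
        then show ?thesis by (simp add: row_eq)
      qed
    qed
  qed
  \<comment> \<open>At \<open>l = m\<close> no weight is left, so any family \<open>y\<close> will
    do.\<close>
  from this[of m "\<lambda>_ _. 0" k] k show ?thesis by (simp add: S_def)
qed

section \<open>Nested sums: Minkowski, interpolation and change of exponents\<close>

text \<open>The recursion of \<open>mixsum\<close> for an arbitrary array, which separates the work
  on exponents from multilinear forms.\<close>

fun array_mixed :: "((nat \<Rightarrow> nat) \<Rightarrow> real) \<Rightarrow> nat \<Rightarrow> nat \<Rightarrow> (nat \<Rightarrow> real) \<Rightarrow> nat \<Rightarrow> (nat \<Rightarrow> nat) \<Rightarrow> real" where
  "array_mixed b n m r 0 idx = b idx"
| "array_mixed b n m r (Suc d) idx =
     (\<Sum>i<n. array_mixed b n m r d (idx(m - Suc d := i)) powr r (m - Suc d)) powr (1 / r (m - Suc d))"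

lemma array_mixed_nonneg: "(\<And>h. b h \<ge> 0) \<Longrightarrow> array_mixed b n m r d idx \<ge> 0"
  by (cases d) auto

lemma array_mixed_two:
  assumes b: "\<And>h. b h \<ge> 0" and "d \<le> m" and r: "\<And>j. m - d \<le> j \<Longrightarrow> j < m \<Longrightarrow> r j = 2"
  shows "array_mixed b n m r d idx = sqrt (msum n {m - d..<m} (\<lambda>h. (b h)\<^sup>2) idx)"
  using assms(2,3)
proof (induction d arbitrary: idx)
  case 0
  then show ?case using b by simp
next
  case (Suc d)
  let ?j = "m - Suc d"
  have "{m - Suc d..<m} = insert ?j {m - d..<m}"
    using Suc.prems by auto
  then have eq: "msum n {m - Suc d..<m} (\<lambda>h. (b h)\<^sup>2) idx
      = (\<Sum>i<n. msum n {m - d..<m} (\<lambda>h. (b h)\<^sup>2) (idx(?j := i)))"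
    using Suc.prems by (simp add: msum_insert)
  have IH: "array_mixed b n m r d idx' = sqrt (msum n {m - d..<m} (\<lambda>h. (b h)\<^sup>2) idx')" for idx'
    using Suc by (intro Suc.IH) auto
  have "r ?j = 2" using Suc.prems by auto
  then have "array_mixed b n m r (Suc d) idx = sqrt (\<Sum>i<n. (array_mixed b n m r d (idx(?j := i)))\<^sup>2)"
    using b by (simp add: array_mixed_nonneg powr_half_sqrt sum_nonneg)
  also have "\<dots> = sqrt (\<Sum>i<n. msum n {m - d..<m} (\<lambda>h. (b h)\<^sup>2) (idx(?j := i)))"
    by (simp add: IH msum_nonneg)
  finally show ?case by (simp add: eq)
qed

text \<open>Minkowski's inequality moves the exponent \<open>\<lambda> \<le> 2\<close> from position \<open>k\<close> to the outside.\<close>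

lemma array_mixed_le_outer:
  assumes b: "\<And>h. b h \<ge> 0" and k: "k < m" and l: "0 < l" "l \<le> 2" and d: "m - k \<le> d" "d \<le> m"
  shows "array_mixed b n m ((\<lambda>_. 2)(k := l)) d idx
    \<le> (\<Sum>i<n. msum n ({m - d..<m} - {k}) (\<lambda>h. (b h)\<^sup>2) (idx(k := i)) powr (l / 2)) powr (1 / l)"
  using d
proof (induction d arbitrary: idx rule: dec_induct)
  \<comment> \<open>Position \<open>k\<close> is now the outermost summed index, so nothing has to
    be moved and equality holds.\<close>
  case base
  obtain e where e: "m - k = Suc e" using k by (metis Suc_diff_Suc)
  have mk: "m - Suc e = k" using e k by simp
  have me: "m - e = Suc k" using e k by simp
  have "array_mixed b n m ((\<lambda>_. 2)(k := l)) (m - k) idx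
      = (\<Sum>i<n. array_mixed b n m ((\<lambda>_. 2)(k := l)) e (idx(k := i)) powr l) powr (1 / l)"
    by (simp add: e mk)
  also have "\<dots> = (\<Sum>i<n. msum n ({m - (m - k)..<m} - {k}) (\<lambda>h. (b h)\<^sup>2) (idx(k := i)) powr (l / 2)) powr (1 / l)"
  proof -
    have "{m - (m - k)..<m} - {k} = {Suc k..<m}" using k by auto
    then have "array_mixed b n m ((\<lambda>_. 2)(k := l)) e (idx(k := i)) powr l
        = msum n ({m - (m - k)..<m} - {k}) (\<lambda>h. (b h)\<^sup>2) (idx(k := i)) powr (l / 2)" for i
      using array_mixed_two[of b e m "(\<lambda>_. 2)(k := l)" n "idx(k := i)"] b e me
      by (simp add: msum_nonneg powr_powr flip: powr_half_sqrt)
    then show ?thesis by simp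
  qed
  finally show ?case by (rule eq_refl)
next
  case (step d)
  let ?j = "m - Suc d"
  let ?G = "\<lambda>i j. msum n ({m - d..<m} - {k}) (\<lambda>h. (b h)\<^sup>2) (idx(k := i, ?j := j))"
  have jk: "?j < k" using step k by simp
  have sumG: "(\<Sum>j<n. ?G i j) = msum n ({m - Suc d..<m} - {k}) (\<lambda>h. (b h)\<^sup>2) (idx(k := i))" for i
  proof -
    have "{m - Suc d..<m} - {k} = insert ?j ({m - d..<m} - {k})"
      using step jk by auto
    then show ?thesis using step by (simp add: msum_insert)
  qed
  have G0: "?G i j \<ge> 0" for i j by (simp add: msum_nonneg)
  have "array_mixed b n m ((\<lambda>_. 2)(k := l)) (Suc d) idx
      = (\<Sum>j<n. array_mixed b n m ((\<lambda>_. 2)(k := l)) d (idx(?j := j)) powr 2) powr (1 / 2)"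
    using jk by simp
  also have "\<dots> \<le> (\<Sum>j<n. ((\<Sum>i<n. ?G i j powr (l / 2)) powr (1 / l)) powr 2) powr (1 / 2)"
  proof (intro powr_mono2 sum_mono sum_nonneg array_mixed_nonneg b)
    fix j
    show "array_mixed b n m ((\<lambda>_. 2)(k := l)) d (idx(?j := j)) \<le> (\<Sum>i<n. ?G i j powr (l / 2)) powr (1 / l)"
    proof -
      have "idx(?j := j, k := i) = idx(k := i, ?j := j)" for i
        using jk by (intro fun_upd_twist) auto
      then show ?thesis
        using step.IH[of "idx(?j := j)"] step.prems by (simp only: le_SucI Suc_leD)
    qed
  qed auto
  also have "\<dots> = ((\<Sum>j<n. (\<Sum>i<n. ?G i j powr (l / 2)) powr (1 / (l / 2))) powr (l / 2)) powr (1 / l)"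
    using l by (simp add: powr_powr)
  \<comment> \<open>Minkowski with \<open>u = l / 2\<close> moves the sum over \<open>i\<close>
    outside the sum over \<open>j\<close>.\<close>
  also have "\<dots> \<le> (\<Sum>i<n. (\<Sum>j<n. ?G i j) powr (l / 2)) powr (1 / l)"
    using l G0 by (intro powr_mono2 Minkowski_powr_sum) auto
  finally show ?case by (simp only: sumG)
qed

text \<open>At each level Hoelder is applied with the weights
  \<open>\<theta> k * q j / s k j\<close>; they sum to 1 precisely because \<open>1 / q j\<close> is
  the convex combination of the \<open>1 / s k j\<close>.\<close>

lemma array_mixed_interpolate:
  assumes b: "\<And>h. b h \<ge> 0"
    and K: "finite K" "\<And>k. k \<in> K \<Longrightarrow> \<theta> k > 0" "(\<Sum>k\<in>K. \<theta> k) = 1"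
    and s: "\<And>k j. k \<in> K \<Longrightarrow> j < m \<Longrightarrow> s k j > 0"
    and q: "\<And>j. j < m \<Longrightarrow> q j > 0" "\<And>j. j < m \<Longrightarrow> 1 / q j = (\<Sum>k\<in>K. \<theta> k / s k j)"
    and d: "d \<le> m"
  shows "array_mixed b n m q d idx \<le> (\<Prod>k\<in>K. array_mixed b n m (s k) d idx powr \<theta> k)"
  using d
proof (induction d arbitrary: idx)
  case 0
  show ?case
  proof (cases "b idx = 0")
    case False
    then have "(\<Prod>k\<in>K. b idx powr \<theta> k) = b idx powr 1"
      using K by (simp add: powr_sum[symmetric] del: powr_one powr_one')
    then show ?thesis using b by simp
  qed (simp add: prod_nonneg)
next
  case (Suc d)
  let ?j = "m - Suc d"
  let ?A = "\<lambda>k i. array_mixed b n m (s k) d (idx(?j := i))"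
  have j: "?j < m" using Suc by simp
  have A0: "?A k i \<ge> 0" for k i using b by (rule array_mixed_nonneg)
  have w: "(\<Sum>k\<in>K. \<theta> k * q ?j / s k ?j) = 1"
  proof -
    have "(\<Sum>k\<in>K. \<theta> k * q ?j / s k ?j) = q ?j * (\<Sum>k\<in>K. \<theta> k / s k ?j)"
      by (simp add: sum_distrib_left mult_ac)
    then show ?thesis using q(1)[OF j] by (simp flip: q(2)[OF j])
  qed
  have "array_mixed b n m q (Suc d) idx
      \<le> (\<Sum>i<n. (\<Prod>k\<in>K. ?A k i powr \<theta> k) powr q ?j) powr (1 / q ?j)"
    unfolding array_mixed.simps
  proof (intro powr_mono2 sum_mono sum_nonneg array_mixed_nonneg b)
    show "array_mixed b n m q d (idx(?j := i)) \<le> (\<Prod>k\<in>K. ?A k i powr \<theta> k)" for i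
      using Suc by simp
  qed (use q(1)[OF j] in auto)
  also have "\<dots> = (\<Sum>i<n. \<Prod>k\<in>K. (?A k i powr s k ?j) powr (\<theta> k * q ?j / s k ?j)) powr (1 / q ?j)"
  proof -
    have "(\<Prod>k\<in>K. ?A k i powr \<theta> k) powr q ?j
       = (\<Prod>k\<in>K. (?A k i powr s k ?j) powr (\<theta> k * q ?j / s k ?j))" for i
      unfolding prod_powr_distrib powr_powr
    proof (intro prod.cong refl arg_cong2[of _ _ _ _ "(powr)"])
      fix k assume "k \<in> K"
      then have "s k ?j > 0" using s j by blast
      then show "\<theta> k * q ?j = s k ?j * (\<theta> k * q ?j / s k ?j)" by simp
    qed
    then show ?thesis by simp
  qed
  also have "\<dots> \<le> (\<Prod>k\<in>K. (\<Sum>i<n. ?A k i powr s k ?j) powr (\<theta> k * q ?j / s k ?j)) powr (1 / q ?j)"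
    using w K q(1)[OF j] s j
    by (intro powr_mono2 Hoelder_prod_sum) (auto intro!: sum_nonneg prod_nonneg)
  also have "\<dots> = (\<Prod>k\<in>K. ((\<Sum>i<n. ?A k i powr s k ?j) powr (\<theta> k * q ?j / s k ?j)) powr (1 / q ?j))"
    by (rule prod_powr_distrib)
  also have "\<dots> = (\<Prod>k\<in>K. array_mixed b n m (s k) (Suc d) idx powr \<theta> k)"
    using q(1)[OF j] by (intro prod.cong refl) (simp add: powr_powr)
  finally show ?case .
qed

text \<open>For \<open>r < q\<close> this is Hoelder against the constant 1, which costs a power of
  \<open>n\<close>. For \<open>q < r\<close> it is the monotonicity of the \<open>l_p\<close> norms,
  from \<open>A i powr r = A i powr (r - q) * A i powr q\<close> and a bound of the first factor by
  the whole \<open>q\<close>-sum.\<close>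

lemma powr_sum_change_exponent:
  fixes A :: "nat \<Rightarrow> real"
  assumes A: "\<And>i. A i \<ge> 0" and r: "0 < r" "0 < q" and n: "n \<ge> 1"
  shows "(\<Sum>i<n. A i powr r) powr (1 / r) \<le> real n powr (max 0 (1 / r - 1 / q)) * (\<Sum>i<n. A i powr q) powr (1 / q)"
proof -
  let ?Q = "(\<Sum>i<n. A i powr q)"
  have Q0: "?Q \<ge> 0" by (simp add: sum_nonneg)
  consider "r < q" | "r = q" | "q < r" by linarith
  then show ?thesis
  proof cases
    case 1
    have "(\<Sum>i<n. A i powr r) = (\<Sum>i<n. (A i powr q) powr (r / q) * 1 powr (1 - r / q))"
      using r by (simp add: powr_powr)
    also have "\<dots> \<le> ?Q powr (r / q) * (\<Sum>i<n. 1) powr (1 - r / q)"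
      using 1 r by (intro Hoelder_two_sum) auto
    finally have "(\<Sum>i<n. A i powr r) powr (1 / r) \<le> (?Q powr (r / q) * real n powr (1 - r / q)) powr (1 / r)"
      using r by (intro powr_mono2) (auto intro: sum_nonneg)
    also have "\<dots> = real n powr ((1 - r / q) * (1 / r)) * ?Q powr (1 / q)"
      using r by (simp add: powr_mult powr_powr mult.commute)
    also have "(1 - r / q) * (1 / r) = max 0 (1 / r - 1 / q)"
      using 1 r by (simp add: field_simps max_def)
    finally show ?thesis .
  next
    case 2
    then show ?thesis using n by simp
  next
    case 3
    then have "1 / r < 1 / q" using r by (simp add: field_simps)
    then have mx: "max 0 (1 / r - 1 / q) = 0" by simp
    have le: "A i powr r \<le> ?Q powr ((r - q) / q) * A i powr q" if "i < n" for i
    proof -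
      have "A i powr q \<le> ?Q" using that by (intro member_le_sum) auto
      then have "(A i powr q) powr ((r - q) / q) \<le> ?Q powr ((r - q) / q)"
        using 3 r by (intro powr_mono2) auto
      moreover have "(A i powr q) powr ((r - q) / q) = A i powr (r - q)" using r by (simp add: powr_powr)
      ultimately have "A i powr (r - q) * A i powr q \<le> ?Q powr ((r - q) / q) * A i powr q"
        by (intro mult_right_mono) auto
      then show ?thesis by (simp flip: powr_add)
    qed
    have "(\<Sum>i<n. A i powr r) \<le> (\<Sum>i<n. ?Q powr ((r - q) / q) * A i powr q)"
      using le by (intro sum_mono) auto
    also have "\<dots> = ?Q powr ((r - q) / q) * ?Q powr 1"
      using Q0 by (simp flip: sum_distrib_left)
    also have "\<dots> = ?Q powr (r / q)"
      unfolding powr_add[symmetric] using r by (simp add: field_simps)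
    finally have "(\<Sum>i<n. A i powr r) powr (1 / r) \<le> (?Q powr (r / q)) powr (1 / r)"
      using r by (intro powr_mono2) (auto intro: sum_nonneg)
    also have "\<dots> = ?Q powr (1 / q)" using r by (simp add: powr_powr)
    finally show ?thesis using n by (simp only: mx) simp
  qed
qed

text \<open>The one-level estimate is applied from the inside out; the accumulated power of
  \<open>n\<close> is independent of the indices and passes through the outer sums.\<close>

lemma array_mixed_change_exponents:
  assumes b: "\<And>h. b h \<ge> 0" and n: "n \<ge> 1"
    and r: "\<And>j. j < m \<Longrightarrow> r j > 0" "\<And>j. j < m \<Longrightarrow> q j > 0" and d: "d \<le> m"
  shows "array_mixed b n m r d idx
    \<le> real n powr (\<Sum>j\<in>{m - d..<m}. max 0 (1 / r j - 1 / q j)) * array_mixed b n m q d idx"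
  using d
proof (induction d arbitrary: idx)
  case 0
  then show ?case using n by simp
next
  case (Suc d)
  let ?j = "m - Suc d"
  let ?N = "real n powr (\<Sum>j\<in>{m - d..<m}. max 0 (1 / r j - 1 / q j))"
  let ?B = "\<lambda>i. array_mixed b n m q d (idx(?j := i))"
  have j: "?j < m" using Suc by simp
  have "array_mixed b n m r (Suc d) idx \<le> (\<Sum>i<n. (?N * ?B i) powr r ?j) powr (1 / r ?j)"
    unfolding array_mixed.simps
  proof (intro powr_mono2 sum_mono sum_nonneg array_mixed_nonneg b)
    show "array_mixed b n m r d (idx(?j := i)) \<le> ?N * ?B i" for i
      using Suc by simp
  qed (use r(1)[OF j] in auto)
  also have "\<dots> \<le> real n powr (max 0 (1 / r ?j - 1 / q ?j)) * (\<Sum>i<n. (?N * ?B i) powr q ?j) powr (1 / q ?j)"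
    using r j n b by (intro powr_sum_change_exponent) (auto intro!: array_mixed_nonneg mult_nonneg_nonneg)
  also have "(\<Sum>i<n. (?N * ?B i) powr q ?j) powr (1 / q ?j) = ?N * array_mixed b n m q (Suc d) idx"
    using r(2)[OF j] b
    by (simp add: powr_mult array_mixed_nonneg sum_nonneg powr_powr flip: sum_distrib_left)
  also have "real n powr (max 0 (1 / r ?j - 1 / q ?j)) * (?N * array_mixed b n m q (Suc d) idx)
     = real n powr (max 0 (1 / r ?j - 1 / q ?j) + (\<Sum>j\<in>{m - d..<m}. max 0 (1 / r j - 1 / q j)))
       * array_mixed b n m q (Suc d) idx"
    by (simp add: powr_add mult_ac)
  also have "max 0 (1 / r ?j - 1 / q ?j) + (\<Sum>j\<in>{m - d..<m}. max 0 (1 / r j - 1 / q j))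
     = (\<Sum>j\<in>{m - Suc d..<m}. max 0 (1 / r j - 1 / q j))"
  proof -
    have "{m - Suc d..<m} = insert ?j {m - d..<m}" using Suc.prems by auto
    then show ?thesis using Suc.prems by simp
  qed
  finally show ?case .
qed

text \<open>The weights distribute a budget \<open>\<delta>\<close> over the deficits
  \<open>\<rho> j\<close>. If the total deficit \<open>R\<close> exceeds the budget, it is shared
  proportionally and no term overshoots. Otherwise every deficit is covered and the surplus goes to
  index 0. For \<open>\<delta> = 0\<close> in the second case all deficits vanish, and the whole
  weight is put on index 0.\<close>

lemma interpolation_weights:
  fixes \<rho> :: "nat \<Rightarrow> real"
  assumes m: "m > 0" and \<rho>: "\<And>j. j < m \<Longrightarrow> \<rho> j \<ge> 0" and \<delta>: "\<delta> \<ge> 0"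
  obtains \<theta> where "\<forall>j<m. \<theta> j \<ge> 0" "(\<Sum>j<m. \<theta> j) = 1"
    "(\<Sum>j<m. max 0 (\<rho> j - \<theta> j * \<delta>)) = max ((\<Sum>j<m. \<rho> j) - \<delta>) 0"
proof -
  define R where "R = (\<Sum>j<m. \<rho> j)"
  show ?thesis
  proof (cases "R > \<delta>")
    case True
    then have R: "R > 0" using \<delta> by simp
    show ?thesis
    proof (rule that[of "\<lambda>j. \<rho> j / R"])
      show "(\<Sum>j<m. \<rho> j / R) = 1" using R by (simp add: R_def flip: sum_divide_distrib)
      have "max 0 (\<rho> j - \<rho> j / R * \<delta>) = \<rho> j - \<rho> j / R * \<delta>" if "j < m" for j
      proof -
        have "\<rho> j * \<delta> \<le> \<rho> j * R" using True \<rho>[OF that] by (intro mult_left_mono) auto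
        then show ?thesis using R by (simp add: field_simps)
      qed
      then have "(\<Sum>j<m. max 0 (\<rho> j - \<rho> j / R * \<delta>)) = (\<Sum>j<m. \<rho> j - \<rho> j / R * \<delta>)"
        by simp
      also have "\<dots> = R - (\<Sum>j<m. \<rho> j) / R * \<delta>"
        by (simp add: sum_subtractf R_def[symmetric] flip: sum_divide_distrib sum_distrib_right)
      also have "\<dots> = R - \<delta>" using R by (simp flip: R_def)
      finally show "(\<Sum>j<m. max 0 (\<rho> j - \<rho> j / R * \<delta>)) = max ((\<Sum>j<m. \<rho> j) - \<delta>) 0"
        using True by (simp add: R_def)
    qed (use R \<rho> in auto)
  next
    case False
    show ?thesis
    proof (cases "\<delta> = 0")
      case True
      then have R0: "(\<Sum>j<m. \<rho> j) = 0" using False \<rho> by (intro antisym sum_nonneg) (auto simp: R_def)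
      then have "\<forall>j<m. \<rho> j = 0" using \<rho> by (subst (asm) sum_nonneg_eq_0_iff) auto
      then show ?thesis using True m R0
        by (intro that[of "\<lambda>j. if j = 0 then 1 else 0"]) (auto simp: sum.delta)
    next
      case nz: False
      then have d: "\<delta> > 0" using \<delta> by simp
      show ?thesis
      proof (rule that[of "\<lambda>j. \<rho> j / \<delta> + (if j = 0 then 1 - R / \<delta> else 0)"])
        have le: "R / \<delta> \<le> 1" using False d by simp
        then show "\<forall>j<m. 0 \<le> \<rho> j / \<delta> + (if j = 0 then 1 - R / \<delta> else 0)"
          using \<rho> d by simp
        show "(\<Sum>j<m. \<rho> j / \<delta> + (if j = 0 then 1 - R / \<delta> else 0)) = 1"
          using m by (simp add: sum.distrib R_def flip: sum_divide_distrib)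
        have "max 0 (\<rho> j - (\<rho> j / \<delta> + (if j = 0 then 1 - R / \<delta> else 0)) * \<delta>) = 0" for j
          using d False by (auto simp: field_simps)
        then show "(\<Sum>j<m. max 0 (\<rho> j - (\<rho> j / \<delta> + (if j = 0 then 1 - R / \<delta> else 0)) * \<delta>))
          = max ((\<Sum>j<m. \<rho> j) - \<delta>) 0"
          using False by (simp add: R_def)
      qed
    qed
  qed
qed

text \<open>The only input about the array is the weighted estimate \<open>hyp\<close>, with outer
  exponent 1 at any position and exponent 2 elsewhere. Removing weights, moving the special exponent
  into place, interpolating and changing exponents are chained here.\<close>

lemma array_mixed_Hardy_Littlewood:
  fixes b :: "(nat \<Rightarrow> nat) \<Rightarrow> real" and t :: "nat \<Rightarrow> real"
  assumes b: "\<And>h. b h \<ge> 0" and m: "m > 0" and n: "n \<ge> 1"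
    and t: "\<And>j. j < m \<Longrightarrow> 0 \<le> t j" and ts: "(\<Sum>j<m. t j) \<le> 1 / 2"
    and r: "\<And>j. j < m \<Longrightarrow> 1 \<le> r j \<and> r j \<le> 2"
    and M: "M \<ge> 0"
    and hyp: "\<And>y k. (\<And>j i. y j i \<ge> (0::real)) \<Longrightarrow> (\<And>j. j < m \<Longrightarrow> unit_ball (t j) n (y j)) \<Longrightarrow> k < m \<Longrightarrow>
       (\<Sum>i<n. sqrt (msum n ({..<m} - {k}) (\<lambda>h. (b h)\<^sup>2 * (\<Prod>j<m. (y j (h j))\<^sup>2)) (idx(k := i)))) \<le> M"
  shows "array_mixed b n m r m idx
    \<le> real n powr (max ((\<Sum>j<m. 1 / r j) - (real m + 1) / 2 + (\<Sum>j<m. t j)) 0) * M"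
proof -
  \<comment> \<open>\<open>l\<close> is the exponent reached once all weights are removed;
    \<open>\<delta>\<close> is the excess of \<open>1 / l\<close> over \<open>1 / 2\<close> that
    interpolation may distribute among the positions.\<close>
  define l where "l = 1 / (1 - (\<Sum>j<m. t j))"
  define \<delta> where "\<delta> = 1 / 2 - (\<Sum>j<m. t j)"
  have t0: "(\<Sum>j<m. t j) \<ge> 0" using t by (intro sum_nonneg) auto
  have l: "1 \<le> l" "l \<le> 2" "1 / l = 1 / 2 + \<delta>"
    using t0 ts by (auto simp: l_def \<delta>_def field_simps)
  define \<rho> where "\<rho> j = 1 / r j - 1 / 2" for j
  have \<rho>: "\<rho> j \<ge> 0" if "j < m" for j using r[OF that] by (simp add: \<rho>_def field_simps)
  have d0: "\<delta> \<ge> 0" using ts by (simp add: \<delta>_def)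
  obtain \<theta> where \<theta>0: "\<forall>j<m. \<theta> j \<ge> 0" and \<theta>': "(\<Sum>j<m. \<theta> j) = 1"
    "(\<Sum>j<m. max 0 (\<rho> j - \<theta> j * \<delta>)) = max ((\<Sum>j<m. \<rho> j) - \<delta>) 0"
    by (rule interpolation_weights[OF m \<rho> d0])
  have \<theta>: "\<theta> j \<ge> 0" if "j < m" for j using \<theta>0 that by blast
  define q where "q j = 1 / (1 / 2 + \<theta> j * \<delta>)" for j
  have q: "q j > 0" if "j < m" for j
    using \<theta>[OF that] d0 by (auto simp: q_def intro!: add_pos_nonneg)
  \<comment> \<open>Interpolation needs strictly positive weights, so the positions with
    \<open>\<theta> k = 0\<close> are dropped.\<close>
  define K where "K = {k. k < m \<and> \<theta> k > 0}"
  have fK: "finite K" by (simp add: K_def)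
  have sK: "(\<Sum>k\<in>K. \<theta> k) = 1"
  proof -
    have "(\<Sum>k\<in>K. \<theta> k) = (\<Sum>j<m. \<theta> j)"
    proof (intro sum.mono_neutral_left ballI)
      fix j assume "j \<in> {..<m} - K"
      then show "\<theta> j = 0" using \<theta>[of j] by (auto simp: K_def)
    qed (auto simp: K_def)
    then show ?thesis using \<theta>'(1) by simp
  qed
  have "array_mixed b n m q m idx \<le> (\<Prod>k\<in>K. array_mixed b n m ((\<lambda>_. 2)(k := l)) m idx powr \<theta> k)"
  proof (rule array_mixed_interpolate)
    fix j assume j: "j < m"
    have "(\<Sum>k\<in>K. \<theta> k / ((\<lambda>_. 2)(k := l)) j) = (\<Sum>k\<in>K. \<theta> k / 2 + (if k = j then \<theta> k * \<delta> else 0))"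
    proof (intro sum.cong refl)
      fix k
      show "\<theta> k / ((\<lambda>_. 2)(k := l)) j = \<theta> k / 2 + (if k = j then \<theta> k * \<delta> else 0)"
      proof (cases "k = j")
        case True
        have "\<theta> j / l = \<theta> j * (1 / l)" by simp
        then show ?thesis using True by (simp only: l(3)) (simp add: algebra_simps)
      qed auto
    qed
    also have "\<dots> = 1 / 2 + (if j \<in> K then \<theta> j * \<delta> else 0)"
      using fK sK by (simp add: sum.distrib sum.delta flip: sum_divide_distrib)
    also have "(if j \<in> K then \<theta> j * \<delta> else 0) = \<theta> j * \<delta>"
      using j \<theta>[OF j] by (auto simp: K_def)
    finally show "1 / q j = (\<Sum>k\<in>K. \<theta> k / ((\<lambda>_. 2)(k := l)) j)"
      by (simp add: q_def)
  next
    show "((\<lambda>_. 2)(k := l)) j > 0" for k j using l(1) by simp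
    show "\<theta> k > 0" if "k \<in> K" for k using that by (simp add: K_def)
  qed (fact b fK sK q order_refl)+
  also have "\<dots> \<le> (\<Prod>k\<in>K. M powr \<theta> k)"
  proof (intro prod_mono conjI powr_mono2 array_mixed_nonneg b)
    fix k assume "k \<in> K"
    then have k: "k < m" "0 \<le> \<theta> k" by (auto simp: K_def)
    have "array_mixed b n m ((\<lambda>_. 2)(k := l)) m idx
      \<le> (\<Sum>i<n. msum n ({m - m..<m} - {k}) (\<lambda>h. (b h)\<^sup>2) (idx(k := i)) powr (l / 2)) powr (1 / l)"
      using k l b by (intro array_mixed_le_outer) auto
    also have "\<dots> \<le> (M powr l) powr (1 / l)"
    proof (rule powr_mono2)
      have "(\<Sum>i<n. msum n ({..<m} - {k}) (\<lambda>h. (b h)\<^sup>2) (idx(k := i)) powr (l / 2)) \<le> M powr l"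
        unfolding l_def by (rule Hardy_Littlewood_mixed_two; fact t ts M hyp k(1))
      then show "(\<Sum>i<n. msum n ({m - m..<m} - {k}) (\<lambda>h. (b h)\<^sup>2) (idx(k := i)) powr (l / 2)) \<le> M powr l"
        by (simp add: lessThan_atLeast0)
    qed (use l d0 in \<open>auto intro: sum_nonneg\<close>)
    also have "\<dots> = M"
    proof -
      have "l * (1 / l) = 1" using l(1) by simp
      then show ?thesis using M by (simp only: powr_powr) simp
    qed
    finally show "array_mixed b n m ((\<lambda>_. 2)(k := l)) m idx \<le> M" .
    show "0 \<le> \<theta> k" by fact
  qed auto
  also have "\<dots> \<le> M"
  proof (cases "M = 0")
    case False
    then show ?thesis using sK M by (simp flip: powr_sum)
  next
    case True
    moreover have "K \<noteq> {}" using sK by auto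
    ultimately show ?thesis using fK by (simp add: power_0_left)
  qed
  finally have qM: "array_mixed b n m q m idx \<le> M" .
  have "array_mixed b n m r m idx
      \<le> real n powr (\<Sum>j\<in>{m - m..<m}. max 0 (1 / r j - 1 / q j)) * array_mixed b n m q m idx"
  proof (rule array_mixed_change_exponents)
    show "r j > 0" if "j < m" for j using r[OF that] by simp
  qed (fact b n q order_refl)+
  \<comment> \<open>Both \<open>1 / r j\<close> and \<open>1 / q j\<close> are measured from
    \<open>1 / 2\<close>, which leaves the deficits minimised by the choice of
    \<open>\<theta>\<close>.\<close>
  also have "(\<Sum>j\<in>{m - m..<m}. max 0 (1 / r j - 1 / q j)) = (\<Sum>j<m. max 0 (\<rho> j - \<theta> j * \<delta>))"
    by (intro sum.cong) (auto simp: q_def \<rho>_def algebra_simps)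
  also have "\<dots> = max ((\<Sum>j<m. 1 / r j) - (real m + 1) / 2 + (\<Sum>j<m. t j)) 0"
    unfolding \<theta>'(2) by (simp add: \<rho>_def \<delta>_def sum_subtractf algebra_simps add_divide_distrib)
  finally show ?thesis using qM by (meson mult_left_mono order_trans powr_ge_zero)
qed

section \<open>Khinchine's inequality\<close>

lemma unit_ball_mono:
  assumes "unit_ball t n y" "t \<ge> 0" "\<And>i. i < n \<Longrightarrow> norm (z i) \<le> norm (y i)"
  shows "unit_ball t n z"
proof (cases "t = 0")
  case True
  then show ?thesis using assms unfolding unit_ball_def by (auto intro: order_trans)
next
  case False
  then have "(\<Sum>i<n. norm (z i) powr (1 / t)) \<le> (\<Sum>i<n. norm (y i) powr (1 / t))"
    using assms by (intro sum_mono powr_mono2) auto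
  then show ?thesis using False assms(1) by (simp add: unit_ball_def)
qed

lemma msum_fun_upd:
  assumes "l \<notin> J"
  shows "msum n J (\<lambda>h. F (h(l := i))) idx = msum n J F (idx(l := i))"
  unfolding msum_def using assms by (intro sum.cong refl arg_cong[of _ _ F]) auto

text \<open>Second minus fourth moment potential: \<open>u \<ge> u\<^sup>2 - (4/27) u\<^sup>4\<close> for \<open>u \<ge> 0\<close>. Here \<open>N\<close> is the
  squared norm of the partial sum and \<open>R\<close> the sum of the squared norms of the remaining vectors;
  \<open>N\<^sup>2 + 6NR + 3R\<^sup>2\<close> bounds the fourth moment of the final norm under random signs.\<close>

definition sign_potential :: "real \<Rightarrow> real \<Rightarrow> real \<Rightarrow> real" where
  "sign_potential \<sigma> N R = (N + R) / \<sigma> - 4 / 27 * (N\<^sup>2 + 6 * N * R + 3 * R\<^sup>2) / \<sigma> ^ 3"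

text \<open>\<open>N1\<close> and \<open>N2\<close> stand for the squared norms after adding and
  subtracting a vector of squared norm \<open>V\<close>. The hypotheses are then the parallelogram
  law and Cauchy-Schwarz. Averaging preserves the second moment part, while the two values of the
  fourth moment part together fall short of twice the old one by at least
  \<open>4 * V\<^sup>2\<close>.\<close>

lemma sign_potential_step:
  assumes "\<sigma> > 0" "N1 + N2 = 2 * N + 2 * V" "(N1 - N2)\<^sup>2 \<le> 16 * N * V"
  shows "2 * sign_potential \<sigma> N (R + V) \<le> sign_potential \<sigma> N1 R + sign_potential \<sigma> N2 R"
proof -
  define q where "q N R = N\<^sup>2 + 6 * N * R + 3 * R\<^sup>2" for N R :: real
  have "2 * (N1\<^sup>2 + N2\<^sup>2) = (N1 + N2)\<^sup>2 + (N1 - N2)\<^sup>2"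
    by (simp add: power2_eq_square algebra_simps)
  then have "2 * (N1\<^sup>2 + N2\<^sup>2) \<le> (2 * N + 2 * V)\<^sup>2 + 16 * N * V"
    using assms by simp
  moreover have "6 * N1 * R + 6 * N2 * R = 6 * (2 * N + 2 * V) * R"
    using assms(2) by (metis distrib_left distrib_right)
  ultimately have "q N1 R + q N2 R \<le> 2 * q N (R + V) - 4 * V\<^sup>2"
    unfolding q_def by (simp add: power2_eq_square algebra_simps)
  then have "q N1 R + q N2 R \<le> 2 * q N (R + V)"
    by (smt (verit) zero_le_power2)
  then have "4 / 27 * (q N1 R + q N2 R) / \<sigma> ^ 3 \<le> 4 / 27 * (2 * q N (R + V)) / \<sigma> ^ 3"
    using assms(1) by (intro divide_right_mono mult_left_mono) auto
  moreover have "(N1 + R) / \<sigma> + (N2 + R) / \<sigma> = 2 * (N + (R + V)) / \<sigma>"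
    using assms(2) by (simp flip: add_divide_distrib)
  ultimately show ?thesis
    unfolding sign_potential_def q_def by (simp add: add_divide_distrib algebra_simps)
qed

text \<open>With \<open>u = sqrt N\<close> this is the scaled form of
  \<open>u \<ge> u\<^sup>2 - (4/27) u ^ 4\<close>. The difference factors with a double root at
  \<open>u = 3 / 2 * \<sigma>\<close>, so 4/27 is the least possible constant.\<close>

lemma sign_potential_end:
  assumes "\<sigma> > 0" "N \<ge> 0"
  shows "sign_potential \<sigma> N 0 \<le> sqrt N"
proof -
  define u where "u = sqrt N"
  have u: "u \<ge> 0" "N = u\<^sup>2" using assms by (auto simp: u_def)
  have "0 \<le> u * ((2 * u - 3 * \<sigma>)\<^sup>2 * (u + 3 * \<sigma>))"
    using u assms by simp
  also have "\<dots> = 27 * \<sigma> ^ 3 * u - 27 * \<sigma>\<^sup>2 * u\<^sup>2 + 4 * u ^ 4"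
    by (simp add: power2_eq_square power3_eq_cube power4_eq_xxxx algebra_simps)
  finally have "(27 * \<sigma>\<^sup>2 * u\<^sup>2 - 4 * u ^ 4) / (27 * \<sigma> ^ 3) \<le> u"
    using assms by (subst pos_divide_le_eq) (auto simp: mult_ac)
  moreover have "(27 * \<sigma>\<^sup>2 * u\<^sup>2 - 4 * u ^ 4) / (27 * \<sigma> ^ 3) = sign_potential \<sigma> N 0"
    using assms by (simp add: sign_potential_def u(2) field_simps power2_eq_square power3_eq_cube power4_eq_xxxx)
  ultimately show ?thesis by (simp add: u_def)
qed

text \<open>The last sign is fixed first. The average of the total potential over its two values is
  at least the old total, so one value does not decrease it; the same signs serve all
  \<open>s\<close> at once. The start \<open>X\<close> is general so that the chosen term can be
  absorbed into it.\<close>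

lemma greedy_signs:
  fixes v :: "nat \<Rightarrow> 's \<Rightarrow> 't \<Rightarrow> real"
  assumes \<sigma>: "\<And>s. s \<in> S \<Longrightarrow> \<sigma> s > 0"
  shows "\<exists>\<epsilon>. (\<forall>j. \<bar>\<epsilon> j\<bar> = 1) \<and>
    (\<Sum>s\<in>S. sign_potential (\<sigma> s) (\<Sum>t\<in>T. (X s t)\<^sup>2) (\<Sum>j<n. \<Sum>t\<in>T. (v j s t)\<^sup>2))
    \<le> (\<Sum>s\<in>S. sign_potential (\<sigma> s) (\<Sum>t\<in>T. (X s t + (\<Sum>j<n. \<epsilon> j * v j s t))\<^sup>2) 0)"
proof (induction n arbitrary: X)
  case 0
  show ?case by (intro exI[of _ "\<lambda>_. 1"]) simp
next
  case (Suc n)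
  define R where "R s = (\<Sum>j<n. \<Sum>t\<in>T. (v j s t)\<^sup>2)" for s
  define V where "V s = (\<Sum>t\<in>T. (v n s t)\<^sup>2)" for s
  define N where "N \<delta> s = (\<Sum>t\<in>T. (X s t + \<delta> * v n s t)\<^sup>2)" for \<delta> :: real and s
  let ?P = "\<lambda>\<delta>. \<Sum>s\<in>S. sign_potential (\<sigma> s) (N \<delta> s) (R s)"
  let ?Q = "\<Sum>s\<in>S. sign_potential (\<sigma> s) (\<Sum>t\<in>T. (X s t)\<^sup>2) (R s + V s)"
  have "2 * ?Q \<le> ?P 1 + ?P (-1)"
    unfolding sum_distrib_left sum.distrib[symmetric]
  proof (intro sum_mono sign_potential_step \<sigma>)
    fix s
    show "N 1 s + N (-1) s = 2 * (\<Sum>t\<in>T. (X s t)\<^sup>2) + 2 * V s"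
      unfolding N_def V_def sum_distrib_left sum.distrib[symmetric]
      by (intro sum.cong) (auto simp: power2_eq_square algebra_simps)
    have "N 1 s - N (-1) s = 4 * (\<Sum>t\<in>T. X s t * v n s t)"
      unfolding N_def sum_distrib_left sum_subtractf[symmetric]
      by (intro sum.cong) (auto simp: power2_eq_square algebra_simps)
    then have "(N 1 s - N (-1) s)\<^sup>2 = 16 * (\<Sum>t\<in>T. X s t * v n s t)\<^sup>2"
      by (simp add: power_mult_distrib)
    also have "\<dots> \<le> 16 * ((\<Sum>t\<in>T. (X s t)\<^sup>2) * V s)"
      unfolding V_def by (intro mult_left_mono Cauchy_Schwarz_ineq_sum) auto
    finally show "(N 1 s - N (-1) s)\<^sup>2 \<le> 16 * (\<Sum>t\<in>T. (X s t)\<^sup>2) * V s"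
      by simp
  qed
  then have "?Q \<le> ?P 1 \<or> ?Q \<le> ?P (-1)" by linarith
  then obtain \<delta> where \<delta>: "\<bar>\<delta>\<bar> = 1" "?Q \<le> ?P \<delta>"
    by (elim disjE) (erule that[rotated], simp)+
  obtain \<epsilon> where \<epsilon>: "\<forall>j. \<bar>\<epsilon> j\<bar> = 1"
    "?P \<delta> \<le> (\<Sum>s\<in>S. sign_potential (\<sigma> s) (\<Sum>t\<in>T. (X s t + \<delta> * v n s t + (\<Sum>j<n. \<epsilon> j * v j s t))\<^sup>2) 0)"
    using Suc.IH[of "\<lambda>s t. X s t + \<delta> * v n s t", folded N_def R_def]
    by (elim exE conjE) (rule that)
  have "(\<Sum>j<Suc n. (\<epsilon>(n := \<delta>)) j * v j s t) = \<delta> * v n s t + (\<Sum>j<n. \<epsilon> j * v j s t)" for s t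
    by (simp add: add.commute)
  then have eq: "X s t + (\<Sum>j<Suc n. (\<epsilon>(n := \<delta>)) j * v j s t)
      = X s t + \<delta> * v n s t + (\<Sum>j<n. \<epsilon> j * v j s t)" for s t
    by simp
  have "?Q \<le> (\<Sum>s\<in>S. sign_potential (\<sigma> s)
      (\<Sum>t\<in>T. (X s t + (\<Sum>j<Suc n. (\<epsilon>(n := \<delta>)) j * v j s t))\<^sup>2) 0)"
    by (simp only: eq) (use \<delta>(2) \<epsilon>(2) in linarith)
  moreover have "\<forall>j. \<bar>(\<epsilon>(n := \<delta>)) j\<bar> = 1" using \<epsilon>(1) \<delta>(1) by simp
  moreover have "(\<Sum>j<Suc n. \<Sum>t\<in>T. (v j s t)\<^sup>2) = R s + V s" for s
    by (simp add: R_def V_def)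
  ultimately show ?case by (intro exI[of _ "\<epsilon>(n := \<delta>)"] conjI) (simp_all only: simp_thms)
qed

text \<open>Each potential is scaled by the full Euclidean norm \<open>\<sigma> s\<close>. Starting
  from the zero partial sum its value is
  \<open>(1 - 3 * 4 / 27) * \<sigma> s = 5 / 9 * \<sigma> s\<close>, and at the end it is at most
  the norm of the signed sum; hence the constant 9/5.\<close>

lemma Khinchine_signs:
  fixes v :: "nat \<Rightarrow> 's \<Rightarrow> 't \<Rightarrow> real"
  assumes S: "finite S"
  obtains \<epsilon> where "\<forall>j. \<bar>\<epsilon> j\<bar> = (1::real)"
    "(\<Sum>s\<in>S. sqrt (\<Sum>j<n. \<Sum>t\<in>T. (v j s t)\<^sup>2))
    \<le> 9 / 5 * (\<Sum>s\<in>S. sqrt (\<Sum>t\<in>T. (\<Sum>j<n. \<epsilon> j * v j s t)\<^sup>2))"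
proof -
  define \<sigma> where "\<sigma> s = sqrt (\<Sum>j<n. \<Sum>t\<in>T. (v j s t)\<^sup>2)" for s
  have s2: "(\<Sum>j<n. \<Sum>t\<in>T. (v j s t)\<^sup>2) = (\<sigma> s)\<^sup>2" for s
    by (simp add: \<sigma>_def sum_nonneg)
  have s0: "\<sigma> s \<ge> 0" for s by (simp add: \<sigma>_def sum_nonneg)
  \<comment> \<open>The potential divides by \<open>\<sigma> s\<close>; the discarded
    \<open>s\<close> contribute nothing to the left side.\<close>
  define S' where "S' = {s\<in>S. \<sigma> s > 0}"
  obtain \<epsilon> where \<epsilon>: "\<forall>j. \<bar>\<epsilon> j\<bar> = 1"
    "(\<Sum>s\<in>S'. sign_potential (\<sigma> s) (\<Sum>t\<in>T. (0::real)\<^sup>2) ((\<sigma> s)\<^sup>2))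
    \<le> (\<Sum>s\<in>S'. sign_potential (\<sigma> s) (\<Sum>t\<in>T. (0 + (\<Sum>j<n. \<epsilon> j * v j s t))\<^sup>2) 0)"
    using greedy_signs[where S = S' and \<sigma> = \<sigma> and T = T and X = "\<lambda>_ _. 0" and n = n and v = v] unfolding s2 by (auto simp: S'_def)
  have "sign_potential (\<sigma> s) 0 ((\<sigma> s)\<^sup>2) = 5 / 9 * \<sigma> s" if "s \<in> S'" for s
    using that by (simp add: S'_def sign_potential_def field_simps power2_eq_square power3_eq_cube)
  then have "5 / 9 * (\<Sum>s\<in>S'. \<sigma> s) = (\<Sum>s\<in>S'. sign_potential (\<sigma> s) (\<Sum>t\<in>T. (0::real)\<^sup>2) ((\<sigma> s)\<^sup>2))"
    unfolding sum_distrib_left by (intro sum.cong refl) simp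
  also note \<epsilon>(2)
  also have "(\<Sum>s\<in>S'. sign_potential (\<sigma> s) (\<Sum>t\<in>T. (0 + (\<Sum>j<n. \<epsilon> j * v j s t))\<^sup>2) 0)
      \<le> (\<Sum>s\<in>S'. sqrt (\<Sum>t\<in>T. (0 + (\<Sum>j<n. \<epsilon> j * v j s t))\<^sup>2))"
    by (intro sum_mono sign_potential_end) (auto simp: S'_def sum_nonneg)
  also have "\<dots> \<le> (\<Sum>s\<in>S. sqrt (\<Sum>t\<in>T. (\<Sum>j<n. \<epsilon> j * v j s t)\<^sup>2))"
    using S by (simp add: S'_def) (intro sum_mono2, auto simp: sum_nonneg)
  also have "(\<Sum>s\<in>S'. \<sigma> s) = (\<Sum>s\<in>S. \<sigma> s)"
    using S s0 by (intro sum.mono_neutral_left) (auto simp: S'_def order_less_le)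
  finally show ?thesis using \<epsilon>(1) by (intro that[of \<epsilon>]) (auto simp: \<sigma>_def)
qed

text \<open>The coordinates of \<open>J\<close> are treated one at a time by the vector-valued
  inequality: the signs depend on the coordinate being removed, while the remaining coordinates form
  the Euclidean index set. Each removal costs a factor 9/5, with signs common to all values of the
  outer index.\<close>

lemma Khinchine_msum:
  fixes c :: "(nat \<Rightarrow> nat) \<Rightarrow> real"
  assumes "finite J" "k \<notin> J"
  shows "\<exists>x. (\<forall>j i. \<bar>x j i\<bar> = (1::real)) \<and>
    (\<Sum>i<n. sqrt (msum n J (\<lambda>h. (c h)\<^sup>2) (idx(k := i))))
    \<le> (9 / 5) ^ card J * (\<Sum>i<n. \<bar>msum n J (\<lambda>h. c h * (\<Prod>j\<in>J. x j (h j))) (idx(k := i))\<bar>)"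
  using assms
proof (induction J arbitrary: c rule: finite_induct)
  case empty
  show ?case by (intro exI[of _ "\<lambda>_ _. 1"]) simp
next
  case (insert l J)
  have lk: "l \<noteq> k" "k \<notin> J" using insert.prems by auto
  define e where "e i g a = (if a \<in> J then g a else (idx(k := i)) a)" for i g a
  obtain \<epsilon> where \<epsilon>: "\<forall>j. \<bar>\<epsilon> j\<bar> = (1::real)"
    and le: "(\<Sum>i<n. sqrt (\<Sum>j<n. \<Sum>g\<in>PiE J (\<lambda>_. {..<n}). (c ((e i g)(l := j)))\<^sup>2))
    \<le> 9 / 5 * (\<Sum>i<n. sqrt (\<Sum>g\<in>PiE J (\<lambda>_. {..<n}). (\<Sum>j<n. \<epsilon> j * c ((e i g)(l := j)))\<^sup>2))"
    by (rule Khinchine_signs[where S = "{..<n}" and n = n and T = "PiE J (\<lambda>_. {..<n})" and v = "\<lambda>j i g. c ((e i g)(l := j))"]) auto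
  \<comment> \<open>The coordinate \<open>l\<close> is summed out against its signs, leaving an
    array on the smaller set \<open>J\<close> for the induction hypothesis.\<close>
  define c' where "c' h = (\<Sum>j<n. \<epsilon> j * c (h(l := j)))" for h
  obtain x where x: "\<forall>j i. \<bar>x j i\<bar> = (1::real)"
    and IH: "(\<Sum>i<n. sqrt (msum n J (\<lambda>h. (c' h)\<^sup>2) (idx(k := i))))
    \<le> (9 / 5) ^ card J * (\<Sum>i<n. \<bar>msum n J (\<lambda>h. c' h * (\<Prod>j\<in>J. x j (h j))) (idx(k := i))\<bar>)"
    using insert.IH[OF lk(2), of c'] by blast
  have L: "(\<Sum>j<n. \<Sum>g\<in>PiE J (\<lambda>_. {..<n}). (c ((e i g)(l := j)))\<^sup>2)
      = msum n (insert l J) (\<lambda>h. (c h)\<^sup>2) (idx(k := i))" for i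
    unfolding msum_insert[OF insert.hyps(2,1)] msum_fun_upd[OF insert.hyps(2), symmetric]
    by (simp add: msum_def e_def[abs_def])
  have R: "(\<Sum>g\<in>PiE J (\<lambda>_. {..<n}). (\<Sum>j<n. \<epsilon> j * c ((e i g)(l := j)))\<^sup>2)
      = msum n J (\<lambda>h. (c' h)\<^sup>2) (idx(k := i))" for i
    by (simp add: msum_def c'_def e_def[abs_def])
  have Q: "msum n J (\<lambda>h. c' h * (\<Prod>j\<in>J. x j (h j))) idx'
     = msum n (insert l J) (\<lambda>h. c h * (\<Prod>j\<in>insert l J. (x(l := \<epsilon>)) j (h j))) idx'" for idx'
  proof -
    define F where "F h = c h * (\<Prod>j\<in>insert l J. (x(l := \<epsilon>)) j (h j))" for h
    have "c' h * (\<Prod>j\<in>J. x j (h j)) = (\<Sum>i<n. F (h(l := i)))" for h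
    proof -
      have "(\<Prod>j\<in>J. (x(l := \<epsilon>)) j ((h(l := i)) j)) = (\<Prod>j\<in>J. x j (h j))" for i
        using insert.hyps by (intro prod.cong) auto
      then show ?thesis
        unfolding F_def c'_def using insert.hyps by (simp add: sum_distrib_left sum_distrib_right mult_ac)
    qed
    then have "msum n J (\<lambda>h. c' h * (\<Prod>j\<in>J. x j (h j))) idx' = (\<Sum>i<n. msum n J F (idx'(l := i)))"
      by (simp add: msum_sum msum_fun_upd[OF insert.hyps(2)])
    then show ?thesis
      using msum_insert[OF insert.hyps(2,1), of n F] by (simp add: F_def[abs_def])
  qed
  have "(\<Sum>i<n. sqrt (msum n (insert l J) (\<lambda>h. (c h)\<^sup>2) (idx(k := i))))
     \<le> 9 / 5 * ((9 / 5) ^ card J * (\<Sum>i<n. \<bar>msum n J (\<lambda>h. c' h * (\<Prod>j\<in>J. x j (h j))) (idx(k := i))\<bar>))"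
    using le IH unfolding L R by linarith
  also have "\<dots> = (9 / 5) ^ card (insert l J) * (\<Sum>i<n. \<bar>msum n (insert l J)
      (\<lambda>h. c h * (\<Prod>j\<in>insert l J. (x(l := \<epsilon>)) j (h j))) (idx(k := i))\<bar>)"
    unfolding Q using insert.hyps by simp
  finally show ?case
    using x \<epsilon> by (intro exI[of _ "x(l := \<epsilon>)"]) (simp add: fun_upd_def)
qed

text \<open>Khinchine removes the \<open>m - 1\<close> coordinates other than \<open>k\<close> from
  the weighted array \<open>c\<close>. A choice of signs at \<open>k\<close> turns the outer sum of
  absolute values into one value of the form, taken at the vectors \<open>y j\<close> multiplied by
  signs, which remain in the unit balls.\<close>

lemma mixed_one_two_le:
  fixes a :: "(nat \<Rightarrow> nat) \<Rightarrow> real"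
  assumes t: "\<And>j. j < m \<Longrightarrow> 0 \<le> t j"
    and a: "\<And>x :: nat \<Rightarrow> nat \<Rightarrow> real. (\<And>j. j < m \<Longrightarrow> unit_ball (t j) n (x j)) \<Longrightarrow>
      \<bar>msum n {..<m} (\<lambda>h. a h * (\<Prod>j<m. x j (h j))) idx\<bar> \<le> M"
    and y: "\<And>j. j < m \<Longrightarrow> unit_ball (t j) n (y j)" and k: "k < m"
  shows "(\<Sum>i<n. sqrt (msum n ({..<m} - {k}) (\<lambda>h. (a h)\<^sup>2 * (\<Prod>j<m. (y j (h j))\<^sup>2)) (idx(k := i))))
     \<le> (9 / 5) ^ (m - 1) * M"
proof -
  let ?J = "{..<m} - {k}"
  define c where "c h = a h * (\<Prod>j<m. y j (h j))" for h
  obtain x where x: "\<forall>j i. \<bar>x j i\<bar> = (1::real)"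
    and le: "(\<Sum>i<n. sqrt (msum n ?J (\<lambda>h. (c h)\<^sup>2) (idx(k := i))))
    \<le> (9 / 5) ^ card ?J * (\<Sum>i<n. \<bar>msum n ?J (\<lambda>h. c h * (\<Prod>j\<in>?J. x j (h j))) (idx(k := i))\<bar>)"
    using Khinchine_msum[of ?J k n c idx] by auto
  \<comment> \<open>\<open>s i\<close> may be 0, so below only the bound 1 on its absolute value is
    used.\<close>
  define s where "s i = sgn (msum n ?J (\<lambda>h. c h * (\<Prod>j\<in>?J. x j (h j))) (idx(k := i)))" for i
  define z where "z j i = y j i * (x(k := s)) j i" for j i
  have "\<bar>msum n {..<m} (\<lambda>h. a h * (\<Prod>j<m. z j (h j))) idx\<bar> \<le> M"
  proof (rule a)
    fix j assume j: "j < m"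
    have "\<bar>(x(k := s)) j i\<bar> \<le> 1" for i
      using x by (auto simp: s_def sgn_if)
    then have "norm (z j i) \<le> norm (y j i)" for i
      by (simp add: z_def abs_mult mult_left_le)
    then show "unit_ball (t j) n (z j)"
      using unit_ball_mono[OF y[OF j] t[OF j]] by blast
  qed
  moreover have "msum n {..<m} (\<lambda>h. a h * (\<Prod>j<m. z j (h j))) idx
      = (\<Sum>i<n. \<bar>msum n ?J (\<lambda>h. c h * (\<Prod>j\<in>?J. x j (h j))) (idx(k := i))\<bar>)"
  proof -
    have "msum n {..<m} (\<lambda>h. a h * (\<Prod>j<m. z j (h j))) idx
        = (\<Sum>i<n. msum n ?J (\<lambda>h. a h * (\<Prod>j<m. z j (h j))) (idx(k := i)))"
      using k by (intro msum_remove) auto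
    also have "\<dots> = (\<Sum>i<n. msum n ?J (\<lambda>h. s i * (c h * (\<Prod>j\<in>?J. x j (h j)))) (idx(k := i)))"
    proof (intro sum.cong refl msum_cong)
      fix i h assume h: "\<And>l. l \<notin> ?J \<Longrightarrow> h l = (idx(k := i)) l"
      have "(\<Prod>j<m. (x(k := s)) j (h j)) = s (h k) * (\<Prod>j\<in>?J. (x(k := s)) j (h j))"
        using k by (subst prod.remove[of _ k]) auto
      also have "(\<Prod>j\<in>?J. (x(k := s)) j (h j)) = (\<Prod>j\<in>?J. x j (h j))"
        by (intro prod.cong) auto
      finally show "a h * (\<Prod>j<m. z j (h j)) = s i * (c h * (\<Prod>j\<in>?J. x j (h j)))"
        using h[of k] by (simp add: z_def c_def prod.distrib mult_ac)
    qed
    also have "\<dots> = (\<Sum>i<n. \<bar>msum n ?J (\<lambda>h. c h * (\<Prod>j\<in>?J. x j (h j))) (idx(k := i))\<bar>)"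
      unfolding msum_distrib_left s_def by (simp add: abs_sgn mult.commute)
    finally show ?thesis .
  qed
  ultimately have "(\<Sum>i<n. \<bar>msum n ?J (\<lambda>h. c h * (\<Prod>j\<in>?J. x j (h j))) (idx(k := i))\<bar>) \<le> M"
    by simp
  then have "(\<Sum>i<n. sqrt (msum n ?J (\<lambda>h. (c h)\<^sup>2) (idx(k := i)))) \<le> (9 / 5) ^ card ?J * M"
    using le by (meson mult_left_mono order_trans zero_le_power divide_nonneg_nonneg zero_le_numeral)
  then show ?thesis using k by (simp add: c_def power_mult_distrib prod_power_distrib)
qed

section \<open>Multilinear forms\<close>

lemma pnorm_le_one_iff:
  fixes v :: "nat \<Rightarrow> 'a::real_normed_vector"
  assumes "1 \<le> q" "n \<ge> 1"
  shows "pnorm q n v \<le> 1 \<longleftrightarrow> unit_ball (inv_ext q) n v"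
proof (cases "q = \<infinity>")
  case True
  have "(\<lambda>i. norm (v i)) ` {..<n} \<noteq> {}" using assms(2) by (auto simp: lessThan_empty_iff)
  then show ?thesis using True by (auto simp: pnorm_def unit_ball_def inv_ext_def)
next
  case False
  then obtain s where s: "q = ereal s" "s \<ge> 1" using assms(1) by (cases q) auto
  define S where "S = (\<Sum>i<n. norm (v i) powr s)"
  have S0: "S \<ge> 0" by (simp add: S_def sum_nonneg)
  have "S powr (1 / s) \<le> 1 \<longleftrightarrow> S \<le> 1"
  proof
    assume "S powr (1 / s) \<le> 1"
    then have "(S powr (1 / s)) powr s \<le> 1 powr s" using s by (intro powr_mono2) auto
    then show "S \<le> 1" using s S0 by (simp add: powr_powr)
  next
    assume "S \<le> 1"
    then have "S powr (1 / s) \<le> 1 powr (1 / s)" using s S0 by (intro powr_mono2) auto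
    then show "S powr (1 / s) \<le> 1" by simp
  qed
  then show ?thesis using s by (simp add: pnorm_def unit_ball_def inv_ext_def S_def)
qed

lemma unit_ball_norm_le:
  assumes "unit_ball t n v" "t \<ge> 0" "i < n"
  shows "norm (v i) \<le> 1"
proof (cases "t = 0")
  case False
  then have t: "t > 0" using assms by simp
  have "norm (v i) powr (1 / t) \<le> (\<Sum>i<n. norm (v i) powr (1 / t))"
    using assms(3) by (intro member_le_sum) auto
  also have "\<dots> \<le> 1" using assms(1) False by (simp add: unit_ball_def)
  finally have "(norm (v i) powr (1 / t)) powr t \<le> 1 powr t"
    using t by (intro powr_mono2) auto
  then show ?thesis using t by (simp add: powr_powr)
qed (use assms in \<open>auto simp: unit_ball_def\<close>)

section \<open>Expansion in coefficients and the operator norm\<close>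

definition unit_tuple :: "nat \<Rightarrow> (nat \<Rightarrow> nat) \<Rightarrow> nat \<Rightarrow> nat \<Rightarrow> 'a::real_normed_field" where
  "unit_tuple m h = (\<lambda>j. if j < m then unit_vec (h j) else (\<lambda>_. 0))"

lemma mixsum_eq_array_mixed:
  "mixsum T n m r d idx = array_mixed (\<lambda>h. norm (T (unit_tuple m h))) n m r d idx"
  by (induction d arbitrary: idx) (simp_all add: unit_tuple_def)

lemma supp_vec_unit_vec: "i < n \<Longrightarrow> supp_vec n (unit_vec i)"
  by (auto simp: supp_vec_def unit_vec_def)

text \<open>Linearity adds one coordinate at a time to the truncations \<open>u k\<close> of
  \<open>x j\<close>; the support condition makes the truncation at \<open>n\<close> equal to
  \<open>x j\<close>.\<close>

lemma multilinear_form_expand_one: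
  assumes T: "multilinear_form n m T" and x: "x \<in> tuples n m" and j: "j < m"
  shows "T x = (\<Sum>i<n. x j i * T (x(j := unit_vec i)))"
proof -
  define u where "u k = (\<lambda>i. if i < k then x j i else 0)" for k
  have lin: "T (x(j := (\<lambda>i. a * v i + b * w i))) = a * T (x(j := v)) + b * T (x(j := w))"
    if "supp_vec n v" "supp_vec n w" for v w a b
    using T x j that unfolding multilinear_form_def by blast
  have "T (x(j := u k)) = (\<Sum>i<k. x j i * T (x(j := unit_vec i)))" if "k \<le> n" for k
    using that
  proof (induction k)
    case 0
    have "supp_vec n (\<lambda>_. 0)" by (simp add: supp_vec_def)
    from lin[OF this this, of 0 0] have "T (x(j := (\<lambda>_. 0))) = 0" by simp
    moreover have "u 0 = (\<lambda>_. 0)" by (simp add: u_def)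
    ultimately show ?case by (simp only: lessThan_0 sum.empty)
  next
    case (Suc k)
    have u_Suc: "u (Suc k) = (\<lambda>i. 1 * u k i + x j k * unit_vec k i)"
      by (auto simp: u_def unit_vec_def less_Suc_eq)
    have kn: "k \<le> n" "k < n" using Suc.prems by auto
    have "supp_vec n (u k)" using kn by (auto simp: u_def supp_vec_def)
    then have "T (x(j := u (Suc k))) = 1 * T (x(j := u k)) + x j k * T (x(j := unit_vec k))"
      unfolding u_Suc by (rule lin[OF _ supp_vec_unit_vec[OF kn(2)]])
    then show ?case
      by (simp only: Suc.IH[OF kn(1)] sum.lessThan_Suc mult_1_left)
  qed
  moreover have "x(j := u n) = x"
    using x j by (auto simp: u_def tuples_def supp_vec_def fun_eq_iff)
  ultimately show ?thesis by (metis order_refl)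
qed

lemma multilinear_form_expand_on:
  assumes T: "multilinear_form n m T" and x: "x \<in> tuples n m" and J: "finite J" "J \<subseteq> {..<m}"
  shows "T x = msum n J (\<lambda>h. T (\<lambda>j. if j \<in> J then unit_vec (h j) else x j) * (\<Prod>j\<in>J. x j (h j))) idx"
  using J
proof (induction J rule: finite_induct)
  case (insert l J)
  define e where "e h = (\<lambda>j. if j \<in> J then unit_vec (h j) else x j)" for h
  define F where "F h = T (\<lambda>j. if j \<in> insert l J then unit_vec (h j) else x j) * (\<Prod>j\<in>insert l J. x j (h j))" for h
  have "T x = msum n J (\<lambda>h. T (e h) * (\<Prod>j\<in>J. x j (h j))) idx"
    using insert by (simp add: e_def)
  also have "\<dots> = msum n J (\<lambda>h. \<Sum>i<n. F (h(l := i))) idx"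
  proof (rule msum_cong)
    fix h assume h: "\<And>l. l \<in> J \<Longrightarrow> h l < n"
    have "e h \<in> tuples n m"
      using x insert.prems h by (auto simp: e_def tuples_def subset_iff supp_vec_unit_vec)
    then have "T (e h) = (\<Sum>i<n. x l i * T ((e h)(l := unit_vec i)))"
      using multilinear_form_expand_one[OF T, of "e h" l] insert.prems insert.hyps by (simp add: e_def)
    moreover have "F (h(l := i)) = x l i * T ((e h)(l := unit_vec i)) * (\<Prod>j\<in>J. x j (h j))" for i
    proof -
      have "(\<lambda>j. if j \<in> insert l J then unit_vec ((h(l := i)) j) else x j) = (e h)(l := unit_vec i)"
        using insert.hyps by (auto simp: e_def)
      moreover have "(\<Prod>j\<in>J. x j ((h(l := i)) j)) = (\<Prod>j\<in>J. x j (h j))"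
        using insert.hyps by (intro prod.cong) auto
      ultimately show ?thesis
        using insert.hyps unfolding F_def by (simp add: mult_ac)
    qed
    ultimately show "T (e h) * (\<Prod>j\<in>J. x j (h j)) = (\<Sum>i<n. F (h(l := i)))"
      by (simp add: sum_distrib_right)
  qed
  also have "\<dots> = (\<Sum>i<n. msum n J F (idx(l := i)))"
    by (simp add: msum_sum msum_fun_upd[OF insert.hyps(2)])
  also have "\<dots> = msum n (insert l J) F idx"
    using msum_insert[OF insert.hyps(2,1), of n F] by simp
  finally show ?case by (simp add: F_def[abs_def])
qed simp

lemma multilinear_form_expand:
  assumes T: "multilinear_form n m T" and x: "x \<in> tuples n m"
  shows "T x = msum n {..<m} (\<lambda>h. T (unit_tuple m h) * (\<Prod>j<m. x j (h j))) idx"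
proof -
  have "(\<lambda>j. if j \<in> {..<m} then unit_vec (h j) else x j) = unit_tuple m h" for h
    using x by (intro ext) (simp add: unit_tuple_def tuples_def)
  then show ?thesis
    using multilinear_form_expand_on[OF T x, of "{..<m}" idx] by simp
qed

text \<open>A real \<open>Sup\<close> is an upper bound only if the set is bounded above. Vectors in
  the balls have entries of norm at most 1, so the sum of the norms of the coefficients is a
  bound.\<close>

lemma norm_le_opnorm:
  assumes T: "multilinear_form n m T" and n: "n \<ge> 1" and p: "\<forall>j<m. 1 \<le> p j" "\<forall>j<m. 0 \<le> inv_ext (p j)"
    and x: "x \<in> tuples n m" "\<And>j. j < m \<Longrightarrow> unit_ball (inv_ext (p j)) n (x j)"
  shows "norm (T x) \<le> opnorm n m p T"
  unfolding opnorm_def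
proof (rule cSup_upper)
  show "norm (T x) \<in> {norm (T x) |x. x \<in> tuples n m \<and> (\<forall>j<m. pnorm (p j) n (x j) \<le> 1)}"
    using x p n by (auto simp: pnorm_le_one_iff)
  show "bdd_above {norm (T x) |x. x \<in> tuples n m \<and> (\<forall>j<m. pnorm (p j) n (x j) \<le> 1)}"
  proof (rule bdd_aboveI)
    fix y assume "y \<in> {norm (T x) |x. x \<in> tuples n m \<and> (\<forall>j<m. pnorm (p j) n (x j) \<le> 1)}"
    then obtain x where y: "y = norm (T x)" "x \<in> tuples n m" "\<forall>j<m. pnorm (p j) n (x j) \<le> 1"
      by blast
    have le1: "norm (x j i) \<le> 1" if "j < m" "i < n" for j i
      using unit_ball_norm_le[of "inv_ext (p j)" n "x j" i] that y(3) p n by (simp add: pnorm_le_one_iff)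
    let ?g = "\<lambda>h j. if j \<in> {..<m} then h j else (0::nat)"
    have "y = norm (\<Sum>h\<in>PiE {..<m} (\<lambda>_. {..<n}). T (unit_tuple m (?g h)) * (\<Prod>j<m. x j (?g h j)))"
      unfolding y(1) multilinear_form_expand[OF T y(2), of "\<lambda>_. 0"] msum_def ..
    also have "\<dots> \<le> (\<Sum>h\<in>PiE {..<m} (\<lambda>_. {..<n}). norm (T (unit_tuple m (?g h))))"
    proof (intro order_trans[OF norm_sum] sum_mono)
      fix h assume h: "h \<in> PiE {..<m} (\<lambda>_. {..<n})"
      have "norm (\<Prod>j<m. x j (?g h j)) \<le> 1"
        unfolding prod_norm[symmetric] using h by (intro prod_le_1) (auto intro!: le1)
      then show "norm (T (unit_tuple m (?g h)) * (\<Prod>j<m. x j (?g h j))) \<le> norm (T (unit_tuple m (?g h)))"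
        by (simp add: norm_mult mult_left_le)
    qed
    finally show "y \<le> (\<Sum>h\<in>PiE {..<m} (\<lambda>_. {..<n}). norm (T (unit_tuple m (?g h))))" .
  qed
qed

lemma opnorm_nonneg:
  assumes "multilinear_form n m T" "n \<ge> 1" "\<forall>j<m. 1 \<le> p j" "\<forall>j<m. 0 \<le> inv_ext (p j)"
  shows "opnorm n m p T \<ge> 0"
proof -
  have "norm (T (\<lambda>_ _. 0)) \<le> opnorm n m p T"
    by (rule norm_le_opnorm[OF assms]) (auto simp: tuples_def supp_vec_def unit_ball_def)
  then show ?thesis using norm_ge_zero order_trans by blast
qed

lemma inv_ext_nonneg: "1 \<le> q \<Longrightarrow> 0 \<le> inv_ext q"
  by (cases q) (auto simp: inv_ext_def)

text \<open>Only the real-linear coordinate functionals \<open>\<phi>\<close>, \<open>\<psi>\<close> distinguish the complex case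
  (real and imaginary part) from the real one (both are the identity).\<close>

lemma mixed_norm_le_opnorm:
  fixes T :: "(nat \<Rightarrow> nat \<Rightarrow> 'a::real_normed_field) \<Rightarrow> 'a" and \<phi> \<psi> :: "'a \<Rightarrow> real"
  assumes \<phi>: "linear \<phi>" "\<And>z. \<bar>\<phi> z\<bar> \<le> norm z" and \<psi>: "linear \<psi>" "\<And>z. \<bar>\<psi> z\<bar> \<le> norm z"
    and \<phi>\<psi>: "\<And>z. (norm z)\<^sup>2 \<le> (\<phi> z)\<^sup>2 + (\<psi> z)\<^sup>2"
    and m: "m > 0" and p: "\<forall>j<m. 1 \<le> p j" and ps: "(\<Sum>j<m. inv_ext (p j)) \<le> 1 / 2"
    and r: "\<forall>j<m. 1 \<le> r j \<and> r j \<le> 2" and n: "n \<ge> 1" and T: "multilinear_form n m T"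
  shows "mixed_norm T n m r \<le> 2 * (9 / 5) ^ (m - 1)
    * real n powr (max ((\<Sum>j<m. 1 / r j) - (real m + 1) / 2 + (\<Sum>j<m. inv_ext (p j))) 0) * opnorm n m p T"
proof -
  have p0: "\<forall>j<m. 0 \<le> inv_ext (p j)" using p inv_ext_nonneg by blast
  define C where "C = (9 / 5) ^ (m - 1) * opnorm n m p T"
  have C0: "C \<ge> 0" unfolding C_def using opnorm_nonneg[OF T n p p0] by simp
  let ?idx = "\<lambda>_::nat. 0::nat"
  define w where "w y h = (\<Prod>j<m. (y j (h j))\<^sup>2)" for y :: "nat \<Rightarrow> nat \<Rightarrow> real" and h :: "nat \<Rightarrow> nat"
  \<comment> \<open>For a real-linear functional \<open>\<eta>\<close> the real array
    \<open>\<eta> (T (unit_tuple m h))\<close> is tested on real vectors only, where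
    \<open>\<eta>\<close> commutes with the form.\<close>
  have part: "(\<Sum>i<n. sqrt (msum n ({..<m} - {k}) (\<lambda>h. (\<eta> (T (unit_tuple m h)))\<^sup>2 * w y h) (?idx(k := i)))) \<le> C"
    if \<eta>: "linear \<eta>" "\<And>z. \<bar>\<eta> z\<bar> \<le> norm z" and k: "k < m"
      and y: "\<And>j. j < m \<Longrightarrow> unit_ball (inv_ext (p j)) n (y j)" for \<eta> :: "'a \<Rightarrow> real" and y k
    unfolding C_def w_def
  proof (rule mixed_one_two_le[OF _ _ y k])
    fix x :: "nat \<Rightarrow> nat \<Rightarrow> real"
    assume x: "\<And>j. j < m \<Longrightarrow> unit_ball (inv_ext (p j)) n (x j)"
    \<comment> \<open>The real vectors are embedded and cut off so that they form an admissible
      tuple.\<close>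
    define z where "z j i = (if j < m \<and> i < n then of_real (x j i) else (0::'a))" for j i
    have z: "z \<in> tuples n m" by (auto simp: z_def tuples_def supp_vec_def)
    have "msum n {..<m} (\<lambda>h. \<eta> (T (unit_tuple m h)) * (\<Prod>j<m. x j (h j))) ?idx
        = msum n {..<m} (\<lambda>h. \<eta> (T (unit_tuple m h) * (\<Prod>j<m. z j (h j)))) ?idx"
    proof (rule msum_cong)
      fix h assume h: "\<And>l. l \<in> {..<m} \<Longrightarrow> h l < n"
      have "(\<Prod>j<m. z j (h j)) = of_real (\<Prod>j<m. x j (h j))"
        unfolding of_real_prod using h by (intro prod.cong) (auto simp: z_def)
      then have "T (unit_tuple m h) * (\<Prod>j<m. z j (h j)) = (\<Prod>j<m. x j (h j)) *\<^sub>R T (unit_tuple m h)"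
        by (simp add: scaleR_conv_of_real mult.commute)
      then show "\<eta> (T (unit_tuple m h)) * (\<Prod>j<m. x j (h j)) = \<eta> (T (unit_tuple m h) * (\<Prod>j<m. z j (h j)))"
        using linear_cmul[OF \<eta>(1)] by (simp add: mult.commute)
    qed
    also have "\<dots> = \<eta> (T z)"
      unfolding multilinear_form_expand[OF T z, of ?idx] msum_def by (simp add: linear_sum[OF \<eta>(1)])
    finally have "\<bar>msum n {..<m} (\<lambda>h. \<eta> (T (unit_tuple m h)) * (\<Prod>j<m. x j (h j))) ?idx\<bar> \<le> norm (T z)"
      using \<eta>(2) by simp
    also have "\<dots> \<le> opnorm n m p T"
    proof (rule norm_le_opnorm[OF T n p p0 z])
      show "unit_ball (inv_ext (p j)) n (z j)" if "j < m" for j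
        using x[OF that] that by (auto simp: unit_ball_def z_def split: if_splits)
    qed
    finally show "\<bar>msum n {..<m} (\<lambda>h. \<eta> (T (unit_tuple m h)) * (\<Prod>j<m. x j (h j))) ?idx\<bar> \<le> opnorm n m p T" .
  qed (use p0 in auto)
  have "array_mixed (\<lambda>h. norm (T (unit_tuple m h))) n m r m ?idx
    \<le> real n powr (max ((\<Sum>j<m. 1 / r j) - (real m + 1) / 2 + (\<Sum>j<m. inv_ext (p j))) 0) * (2 * C)"
  proof (rule array_mixed_Hardy_Littlewood)
    fix y :: "nat \<Rightarrow> nat \<Rightarrow> real" and k
    assume y: "\<And>j. j < m \<Longrightarrow> unit_ball (inv_ext (p j)) n (y j)" and k: "k < m"
    let ?S = "\<lambda>\<eta> i. msum n ({..<m} - {k}) (\<lambda>h. (\<eta> (T (unit_tuple m h)))\<^sup>2 * w y h) (?idx(k := i))"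
    have w0: "w y h \<ge> 0" for h unfolding w_def by (intro prod_nonneg) auto
    have S0: "?S \<eta> i \<ge> 0" for \<eta> i by (intro msum_nonneg mult_nonneg_nonneg w0) auto
    \<comment> \<open>Subadditivity of \<open>sqrt\<close> separates the two functionals; this is
      the origin of the factor 2.\<close>
    have "sqrt (?S norm i) \<le> sqrt (?S \<phi> i) + sqrt (?S \<psi> i)" for i
    proof -
      have "?S norm i \<le> ?S \<phi> i + ?S \<psi> i"
        unfolding msum_def sum.distrib[symmetric] distrib_right[symmetric]
        by (intro sum_mono mult_right_mono \<phi>\<psi> w0)
      then have "sqrt (?S norm i) \<le> sqrt (?S \<phi> i + ?S \<psi> i)" by simp
      also have "\<dots> \<le> sqrt (?S \<phi> i) + sqrt (?S \<psi> i)"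
        by (rule sqrt_add_le_add_sqrt[OF S0 S0])
      finally show ?thesis .
    qed
    then have "(\<Sum>i<n. sqrt (?S norm i)) \<le> (\<Sum>i<n. sqrt (?S \<phi> i)) + (\<Sum>i<n. sqrt (?S \<psi> i))"
      unfolding sum.distrib[symmetric] by (intro sum_mono)
    also have "\<dots> \<le> 2 * C"
      using part[OF \<phi> k, of y] part[OF \<psi> k, of y] y by simp
    finally show "(\<Sum>i<n. sqrt (msum n ({..<m} - {k})
        (\<lambda>h. (norm (T (unit_tuple m h)))\<^sup>2 * (\<Prod>j<m. (y j (h j))\<^sup>2)) (?idx(k := i)))) \<le> 2 * C"
      by (simp add: w_def)
  qed (use m n p0 ps r C0 in auto)
  then show ?thesis
    by (simp add: mixed_norm_def mixsum_eq_array_mixed C_def mult_ac)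
qed

section \<open>Optimality of the exponent\<close>

text \<open>The derivative of \<open>ln (cosh u)\<close> is \<open>tanh u\<close>, which is at most
  \<open>u\<close> for \<open>u \<ge> 0\<close>; both comparisons start from equality at 0.\<close>

lemma cosh_le_exp_half_square: "cosh (x::real) \<le> exp (x\<^sup>2 / 2)"
proof -
  have tanh_le: "tanh y \<le> y" if "y \<ge> 0" for y :: real
  proof -
    have "0 - tanh 0 \<le> y - tanh y"
    proof (rule DERIV_nonneg_imp_nondecreasing[OF that])
      fix u :: real
      have "((\<lambda>u. u - tanh u) has_real_derivative 1 - (1 - (tanh u)\<^sup>2)) (at u)"
        by (auto intro!: derivative_eq_intros)
      then show "\<exists>d. ((\<lambda>u. u - tanh u) has_real_derivative d) (at u) \<and> 0 \<le> d" by auto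
    qed
    then show ?thesis by simp
  qed
  have *: "cosh y \<le> exp (y\<^sup>2 / 2)" if "y \<ge> 0" for y :: real
  proof -
    have "0\<^sup>2 / 2 - ln (cosh 0) \<le> y\<^sup>2 / 2 - ln (cosh y)"
    proof (rule DERIV_nonneg_imp_nondecreasing[OF that])
      fix u :: real assume u: "0 \<le> u"
      have "((\<lambda>u. u\<^sup>2 / 2 - ln (cosh u)) has_real_derivative u - sinh u / cosh u) (at u)"
        by (rule derivative_eq_intros refl cosh_real_pos | simp)+
      then show "\<exists>d. ((\<lambda>u. u\<^sup>2 / 2 - ln (cosh u)) has_real_derivative d) (at u) \<and> 0 \<le> d"
        using tanh_le[OF u] by (intro exI[of _ "u - sinh u / cosh u"]) (simp add: tanh_def)
    qed
    then have "ln (cosh y) \<le> y\<^sup>2 / 2" by simp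
    then have "exp (ln (cosh y)) \<le> exp (y\<^sup>2 / 2)" by (simp only: exp_le_cancel_iff)
    then show ?thesis by simp
  qed
  show ?thesis
  proof (cases "x \<ge> 0")
    case False
    then show ?thesis using *[of "- x"] by simp
  qed (rule *)
qed

text \<open>Averaging \<open>cosh (\<delta> * f + X)\<close> over the two signs gives
  \<open>cosh f * cosh X\<close>, and the first factor is at most
  \<open>exp (f\<^sup>2 / 2)\<close>. One of the signs does at least as well as the average for the
  whole weighted sum.\<close>

lemma greedy_signs_cosh:
  fixes f :: "'f \<Rightarrow> 'o \<Rightarrow> real"
  assumes "finite \<Omega>" "\<And>\<phi>. \<phi> \<in> F \<Longrightarrow> w \<phi> \<ge> 0"
  shows "\<exists>\<epsilon>. (\<forall>z. \<bar>\<epsilon> z\<bar> = (1::real)) \<and>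
    (\<Sum>\<phi>\<in>F. w \<phi> * cosh (\<Sum>z\<in>\<Omega>. \<epsilon> z * f \<phi> z)) \<le> (\<Sum>\<phi>\<in>F. w \<phi> * exp ((\<Sum>z\<in>\<Omega>. (f \<phi> z)\<^sup>2) / 2))"
  using assms
proof (induction \<Omega> arbitrary: w rule: finite_induct)
  case empty
  show ?case by (intro exI[of _ "\<lambda>_. 1"]) simp
next
  case (insert a \<Omega>)
  \<comment> \<open>The weights anticipate the cost of the sign at \<open>a\<close>, which is chosen
    after all signs on \<open>\<Omega>\<close>.\<close>
  define w' where "w' \<phi> = w \<phi> * exp ((f \<phi> a)\<^sup>2 / 2)" for \<phi>
  have w'0: "w' \<phi> \<ge> 0" if "\<phi> \<in> F" for \<phi> using insert.prems[OF that] by (simp add: w'_def)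
  have "\<exists>\<epsilon>. (\<forall>z. \<bar>\<epsilon> z\<bar> = (1::real)) \<and>
    (\<Sum>\<phi>\<in>F. w' \<phi> * cosh (\<Sum>z\<in>\<Omega>. \<epsilon> z * f \<phi> z)) \<le> (\<Sum>\<phi>\<in>F. w' \<phi> * exp ((\<Sum>z\<in>\<Omega>. (f \<phi> z)\<^sup>2) / 2))"
    by (rule insert.IH) (rule w'0)
  then obtain \<epsilon> where \<epsilon>: "\<forall>z. \<bar>\<epsilon> z\<bar> = (1::real)"
    and le: "(\<Sum>\<phi>\<in>F. w' \<phi> * cosh (\<Sum>z\<in>\<Omega>. \<epsilon> z * f \<phi> z)) \<le> (\<Sum>\<phi>\<in>F. w' \<phi> * exp ((\<Sum>z\<in>\<Omega>. (f \<phi> z)\<^sup>2) / 2))"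
    by (elim exE conjE)
  let ?X = "\<lambda>\<phi>. \<Sum>z\<in>\<Omega>. \<epsilon> z * f \<phi> z"
  let ?P = "\<lambda>\<delta>. \<Sum>\<phi>\<in>F. w \<phi> * cosh (\<delta> * f \<phi> a + ?X \<phi>)"
  have "?P 1 + ?P (-1) = (\<Sum>\<phi>\<in>F. 2 * (w \<phi> * cosh (f \<phi> a) * cosh (?X \<phi>)))"
    unfolding sum.distrib[symmetric] by (intro sum.cong) (simp_all add: cosh_add cosh_diff algebra_simps)
  also have "\<dots> \<le> (\<Sum>\<phi>\<in>F. 2 * (w' \<phi> * cosh (?X \<phi>)))"
    unfolding w'_def using insert.prems
    by (intro sum_mono mult_left_mono mult_right_mono cosh_le_exp_half_square) auto
  also have "\<dots> \<le> 2 * (\<Sum>\<phi>\<in>F. w' \<phi> * exp ((\<Sum>z\<in>\<Omega>. (f \<phi> z)\<^sup>2) / 2))"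
    using le by (simp flip: sum_distrib_left)
  finally have "\<exists>\<delta>. \<bar>\<delta>\<bar> = 1 \<and> ?P \<delta> \<le> (\<Sum>\<phi>\<in>F. w' \<phi> * exp ((\<Sum>z\<in>\<Omega>. (f \<phi> z)\<^sup>2) / 2))"
    by (cases "?P 1 \<le> (\<Sum>\<phi>\<in>F. w' \<phi> * exp ((\<Sum>z\<in>\<Omega>. (f \<phi> z)\<^sup>2) / 2))")
      (rule exI[of _ 1], simp, rule exI[of _ "-1"], simp)
  then obtain \<delta> where \<delta>: "\<bar>\<delta>\<bar> = 1" "?P \<delta> \<le> (\<Sum>\<phi>\<in>F. w' \<phi> * exp ((\<Sum>z\<in>\<Omega>. (f \<phi> z)\<^sup>2) / 2))"
    by (elim exE conjE)
  have X: "(\<Sum>z\<in>insert a \<Omega>. (\<epsilon>(a := \<delta>)) z * f \<phi> z) = \<delta> * f \<phi> a + ?X \<phi>" for \<phi>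
  proof -
    have "(\<Sum>z\<in>\<Omega>. (\<epsilon>(a := \<delta>)) z * f \<phi> z) = ?X \<phi>"
      using insert.hyps by (intro sum.cong) auto
    then show ?thesis using insert.hyps by simp
  qed
  have W: "w' \<phi> * exp ((\<Sum>z\<in>\<Omega>. (f \<phi> z)\<^sup>2) / 2) = w \<phi> * exp ((\<Sum>z\<in>insert a \<Omega>. (f \<phi> z)\<^sup>2) / 2)" for \<phi>
    using insert.hyps by (simp add: w'_def add_divide_distrib exp_add)
  show ?case
  proof (intro exI conjI)
    show "\<forall>z. \<bar>(\<epsilon>(a := \<delta>)) z\<bar> = 1" using \<epsilon> \<delta>(1) by simp
    show "(\<Sum>\<phi>\<in>F. w \<phi> * cosh (\<Sum>z\<in>insert a \<Omega>. (\<epsilon>(a := \<delta>)) z * f \<phi> z))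
      \<le> (\<Sum>\<phi>\<in>F. w \<phi> * exp ((\<Sum>z\<in>insert a \<Omega>. (f \<phi> z)\<^sup>2) / 2))"
      unfolding X using \<delta>(2) by (simp only: W)
  qed
qed

text \<open>The Chernoff argument with a union bound: \<open>exp \<bar>\<mu> * X\<bar>\<close> is at
  most twice one summand of the total over \<open>F\<close>, hence at most
  \<open>2 * card F * exp (\<mu>\<^sup>2 * s / 2)\<close>. Logarithms are taken and divided by the
  free parameter \<open>\<mu>\<close>.\<close>

lemma uniformly_small_signed_sums:
  fixes f :: "'f \<Rightarrow> 'o \<Rightarrow> real"
  assumes fin: "finite \<Omega>" "finite F" and \<mu>: "\<mu> > 0"
    and s: "\<And>\<phi>. \<phi> \<in> F \<Longrightarrow> (\<Sum>z\<in>\<Omega>. (f \<phi> z)\<^sup>2) \<le> s" and L: "2 * real (card F) \<le> exp L"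
  obtains \<epsilon> where "\<forall>z. \<bar>\<epsilon> z\<bar> = (1::real)"
    "\<forall>\<phi>\<in>F. \<bar>\<Sum>z\<in>\<Omega>. \<epsilon> z * f \<phi> z\<bar> \<le> L / \<mu> + \<mu> * s / 2"
proof -
  obtain \<epsilon> where \<epsilon>: "\<forall>z. \<bar>\<epsilon> z\<bar> = (1::real)"
    and le: "(\<Sum>\<phi>\<in>F. 1 * cosh (\<Sum>z\<in>\<Omega>. \<epsilon> z * (\<mu> * f \<phi> z)))
       \<le> (\<Sum>\<phi>\<in>F. 1 * exp ((\<Sum>z\<in>\<Omega>. (\<mu> * f \<phi> z)\<^sup>2) / 2))"
    using greedy_signs_cosh[OF fin(1), where F = F and w = "\<lambda>_. 1" and f = "\<lambda>\<phi> z. \<mu> * f \<phi> z"]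
    by auto
  have "\<bar>\<Sum>z\<in>\<Omega>. \<epsilon> z * f \<phi> z\<bar> \<le> L / \<mu> + \<mu> * s / 2" if \<phi>: "\<phi> \<in> F" for \<phi>
  proof -
    define X where "X = (\<Sum>z\<in>\<Omega>. \<epsilon> z * f \<phi> z)"
    have X: "(\<Sum>z\<in>\<Omega>. \<epsilon> z * (\<mu> * f \<phi> z)) = \<mu> * X"
      by (simp add: X_def sum_distrib_left mult_ac)
    have "exp \<bar>\<mu> * X\<bar> \<le> 2 * cosh (\<mu> * X)"
      by (cases "\<mu> * X \<ge> 0") (auto simp: cosh_field_def)
    also have "cosh (\<mu> * X) \<le> (\<Sum>\<phi>\<in>F. cosh (\<Sum>z\<in>\<Omega>. \<epsilon> z * (\<mu> * f \<phi> z)))"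
      unfolding X[symmetric] using fin(2) \<phi>
      by (intro member_le_sum[of \<phi> F "\<lambda>\<phi>. cosh (\<Sum>z\<in>\<Omega>. \<epsilon> z * (\<mu> * f \<phi> z))"]) auto
    also have "\<dots> \<le> (\<Sum>\<phi>\<in>F. exp ((\<Sum>z\<in>\<Omega>. (\<mu> * f \<phi> z)\<^sup>2) / 2))"
      using le by simp
    also have "\<dots> \<le> (\<Sum>\<phi>\<in>F. exp (\<mu>\<^sup>2 * s / 2))"
      using s by (intro sum_mono) (simp add: power_mult_distrib mult_left_mono flip: sum_distrib_left)
    finally have "exp \<bar>\<mu> * X\<bar> \<le> (2 * real (card F)) * exp (\<mu>\<^sup>2 * s / 2)" by simp
    also have "\<dots> \<le> exp L * exp (\<mu>\<^sup>2 * s / 2)"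
      using L by (intro mult_right_mono) auto
    also have "\<dots> = exp (L + \<mu>\<^sup>2 * s / 2)" by (simp add: exp_add)
    finally have "\<mu> * \<bar>X\<bar> \<le> L + \<mu>\<^sup>2 * s / 2" using \<mu> by (simp add: abs_mult)
    then have "\<mu> * \<bar>X\<bar> / \<mu> \<le> (L + \<mu>\<^sup>2 * s / 2) / \<mu>"
      using \<mu> by (intro divide_right_mono) auto
    then show ?thesis using \<mu> by (simp add: X_def add_divide_distrib power2_eq_square)
  qed
  then show ?thesis using \<epsilon> that by blast
qed

section \<open>Discretisation and signed tensors of small norm\<close>

definition complex_grid :: "nat \<Rightarrow> complex set" where
  "complex_grid K = (\<lambda>(a, b). Complex (real_of_int a / real K) (real_of_int b / real K)) `
     ({- int K..int K} \<times> {- int K..int K})"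

lemma finite_complex_grid: "finite (complex_grid K)"
  by (simp add: complex_grid_def)

lemma card_complex_grid: "card (complex_grid K) \<le> (2 * K + 1)\<^sup>2"
proof -
  have "card (complex_grid K) \<le> card ({- int K..int K} \<times> {- int K..int K})"
    unfolding complex_grid_def by (intro card_image_le) auto
  also have "\<dots> = (2 * K + 1)\<^sup>2"
    by (simp add: card_cartesian_product power2_eq_square nat_add_distrib nat_mult_distrib)
  finally show ?thesis .
qed

text \<open>Real and imaginary parts are rounded towards 0, so the modulus cannot grow; each
  contributes an error of at most \<open>1 / K\<close>.\<close>

lemma complex_grid_approx:
  assumes z: "norm z \<le> 1" and K: "K \<ge> 1"
  obtains v where "v \<in> complex_grid K" "norm v \<le> norm z" "norm (z - v) \<le> 2 / real K"
proof -
  have approx: "\<exists>a::int. \<bar>a\<bar> \<le> int K \<and> \<bar>real_of_int a / real K\<bar> \<le> \<bar>u\<bar> \<and> \<bar>u - real_of_int a / real K\<bar> \<le> 1 / real K"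
    if u: "\<bar>u\<bar> \<le> 1" for u :: real
  proof -
    have pos: "\<exists>a::int. 0 \<le> a \<and> a \<le> int K \<and> real_of_int a / real K \<le> u \<and> u - real_of_int a / real K \<le> 1 / real K"
      if u: "0 \<le> u" "u \<le> 1" for u :: real
    proof (intro exI[of _ "\<lfloor>real K * u\<rfloor>"] conjI)
      show "0 \<le> \<lfloor>real K * u\<rfloor>" using u by simp
      have "real K * u \<le> real K * 1" using u by (intro mult_left_mono) auto
      then show "\<lfloor>real K * u\<rfloor> \<le> int K" by (simp add: floor_le_iff)
      have "real_of_int \<lfloor>real K * u\<rfloor> \<le> real K * u" by simp
      then show "real_of_int \<lfloor>real K * u\<rfloor> / real K \<le> u" using K by (simp add: field_simps)
      have "real K * u \<le> real_of_int \<lfloor>real K * u\<rfloor> + 1" by linarith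
      then show "u - real_of_int \<lfloor>real K * u\<rfloor> / real K \<le> 1 / real K"
      proof -
        have "u * real K \<le> real_of_int \<lfloor>real K * u\<rfloor> + 1" by (subst mult.commute) fact
        then have "u \<le> (real_of_int \<lfloor>real K * u\<rfloor> + 1) / real K"
          using K by (subst pos_le_divide_eq) auto
        then show ?thesis by (simp add: add_divide_distrib)
      qed
    qed
    show ?thesis
    proof (cases "u \<ge> 0")
      case True
      then obtain a :: int where a: "0 \<le> a" "a \<le> int K" "real_of_int a / real K \<le> u" "u - real_of_int a / real K \<le> 1 / real K"
        using pos[of u] u by auto
      then show ?thesis using True by (intro exI[of _ a]) auto
    next
      case False
      then obtain a :: int where a: "0 \<le> a" "a \<le> int K" "real_of_int a / real K \<le> - u" "- u - real_of_int a / real K \<le> 1 / real K"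
        using pos[of "- u"] u by auto
      then show ?thesis using False by (intro exI[of _ "- a"]) auto
    qed
  qed
  obtain a :: int where a: "\<bar>a\<bar> \<le> int K" "\<bar>real_of_int a / real K\<bar> \<le> \<bar>Re z\<bar>" "\<bar>Re z - real_of_int a / real K\<bar> \<le> 1 / real K"
    using approx[of "Re z"] abs_Re_le_cmod[of z] z by auto
  obtain b :: int where b: "\<bar>b\<bar> \<le> int K" "\<bar>real_of_int b / real K\<bar> \<le> \<bar>Im z\<bar>" "\<bar>Im z - real_of_int b / real K\<bar> \<le> 1 / real K"
    using approx[of "Im z"] abs_Im_le_cmod[of z] z by auto
  define v where "v = Complex (real_of_int a / real K) (real_of_int b / real K)"
  show ?thesis
  proof (rule that[of v])
    show "v \<in> complex_grid K"
      unfolding complex_grid_def v_def using a(1) b(1) by (intro image_eqI[of _ _ "(a, b)"]) auto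
    have "(Re v)\<^sup>2 \<le> (Re z)\<^sup>2" "(Im v)\<^sup>2 \<le> (Im z)\<^sup>2"
      using a(2) b(2) unfolding v_def complex.sel abs_le_square_iff .
    then show "norm v \<le> norm z" by (simp add: cmod_def)
    have "norm (z - v) \<le> \<bar>Re (z - v)\<bar> + \<bar>Im (z - v)\<bar>" by (rule cmod_le)
    also have "\<dots> \<le> 2 / real K" using a(3) b(3) by (simp add: v_def)
    finally show "norm (z - v) \<le> 2 / real K" .
  qed
qed

text \<open>Hoelder against the constant 1 with weight \<open>2 * t\<close>; the endpoints, where
  this weight is 0 or 1, are direct.\<close>

lemma unit_ball_sum_squares_le:
  assumes v: "unit_ball t n v" and t: "0 \<le> t" "t \<le> 1 / 2" and n: "n \<ge> 1"
  shows "(\<Sum>i<n. (norm (v i))\<^sup>2) \<le> real n powr (1 - 2 * t)"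
proof -
  consider "t = 0" | "t = 1 / 2" | "0 < t" "t < 1 / 2" using t by linarith
  then show ?thesis
  proof cases
    case 1
    then have "(\<Sum>i<n. (norm (v i))\<^sup>2) \<le> (\<Sum>i<n. 1)"
      using v by (intro sum_mono) (auto simp: unit_ball_def abs_square_le_1)
    then show ?thesis using 1 by simp
  next
    case 2
    have "t \<noteq> 0" "1 / t = 2" and t0: "1 - 2 * t = 0" by (simp_all add: 2)
    then show ?thesis unfolding t0 using v n by (simp add: unit_ball_def)
  next
    case 3
    have "(\<Sum>i<n. (norm (v i))\<^sup>2) = (\<Sum>i<n. (norm (v i) powr (1 / t)) powr (2 * t) * 1 powr (1 - 2 * t))"
      using 3 by (simp add: powr_powr)
    also have "\<dots> \<le> (\<Sum>i<n. norm (v i) powr (1 / t)) powr (2 * t) * (\<Sum>i<n. 1) powr (1 - 2 * t)"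
      using 3 by (intro Hoelder_two_sum) auto
    also have "\<dots> \<le> 1 * real n powr (1 - 2 * t)"
      using v 3 by (intro mult_mono powr_le1) (auto simp: unit_ball_def sum_nonneg)
    finally show ?thesis by simp
  qed
qed

text \<open>Rounding towards \<open>0\<close> to a grid of mesh \<open>1 / n ^ m\<close> keeps the vectors in the unit balls, changes the
  form by \<open>O(1)\<close>, and leaves \<open>exp (O(n log n))\<close> tuples of vectors to control simultaneously.\<close>

lemma exists_small_signed_tensor:
  fixes t :: "nat \<Rightarrow> real"
  assumes t: "\<And>j. j < m \<Longrightarrow> 0 \<le> t j" "\<And>j. j < m \<Longrightarrow> t j \<le> 1 / 2" and ts: "(\<Sum>j<m. t j) \<le> 1 / 2"
    and n: "n \<ge> 1"
  obtains \<epsilon> :: "(nat \<Rightarrow> nat) \<Rightarrow> real" where "\<forall>h. \<bar>\<epsilon> h\<bar> = 1"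
    "\<And>x :: nat \<Rightarrow> nat \<Rightarrow> complex. (\<And>j. j < m \<Longrightarrow> unit_ball (t j) n (x j)) \<Longrightarrow>
      cmod (msum n {..<m} (\<lambda>h. of_real (\<epsilon> h) * (\<Prod>j<m. x j (h j))) idx)
      \<le> real n powr ((real m + 1) / 2 - (\<Sum>j<m. t j)) * (8 + 10 * real m + 4 * (real m)\<^sup>2 * ln (real n))"
proof -
  \<comment> \<open>There are \<open>n ^ m\<close> terms, each perturbed by at most
    \<open>2 * m / K\<close>, so this mesh makes the total rounding error
    \<open>2 * m\<close>.\<close>
  define K where "K = n ^ m"
  have K: "K \<ge> 1" using n by (simp add: K_def)
  define \<tau> where "\<tau> = (\<Sum>j<m. t j)"
  define e where "e = (real m + 1) / 2 - \<tau>"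
  define P where "P = PiE {..<m} (\<lambda>_. {..<n})"
  define G where "G = PiE {..<m} (\<lambda>_. PiE {..<n} (\<lambda>_. complex_grid K))"
  define G' where "G' = {g \<in> G. \<forall>j<m. unit_ball (t j) n (g j)}"
  \<comment> \<open>The Boolean selects the real or the imaginary part of the product.\<close>
  define F where "F = G' \<times> (UNIV :: bool set)"
  define f where "f \<phi> z = (if snd \<phi> then Re else Im) (\<Prod>j<m. fst \<phi> j (z j))"
    for \<phi> :: "(nat \<Rightarrow> nat \<Rightarrow> complex) \<times> bool" and z :: "nat \<Rightarrow> nat"
  define s where "s = real n powr (real m - 2 * \<tau>)"
  \<comment> \<open>\<open>exp L\<close> is \<open>4 * (2 * K + 1) ^ (2 * n * m)\<close>: the bound
    on the number of grid tuples, doubled for the two parts and once more for the union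
    bound.\<close>
  define L where "L = ln 4 + real (2 * n * m) * ln (real (2 * K + 1))"
  \<comment> \<open>This is \<open>sqrt (n / s)\<close>; it balances \<open>L / \<mu>\<close> and
    \<open>\<mu> * s\<close> up to the logarithm in \<open>L\<close>.\<close>
  define \<mu> where "\<mu> = real n powr (1 / 2 - real m / 2 + \<tau>)"
  have finG: "finite G" unfolding G_def by (intro finite_PiE finite_complex_grid) auto
  have finF: "finite F" using finG by (simp add: F_def G'_def)
  have finP: "finite P" unfolding P_def by (intro finite_PiE) auto
  have \<mu>0: "\<mu> > 0" using n by (simp add: \<mu>_def)
  have card: "2 * real (card F) \<le> exp L"
  proof -
    have "card G = (card (complex_grid K) ^ n) ^ m"
      by (simp add: G_def card_PiE)
    also have "\<dots> \<le> (((2 * K + 1)\<^sup>2) ^ n) ^ m"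
      by (intro power_mono card_complex_grid) auto
    also have "\<dots> = (2 * K + 1) ^ (2 * n * m)"
      by (simp add: power_mult)
    finally have "card G \<le> (2 * K + 1) ^ (2 * n * m)" .
    moreover have "card F \<le> card G * 2"
      unfolding F_def using finG by (simp add: card_cartesian_product G'_def card_mono)
    ultimately have "2 * card F \<le> 4 * (2 * K + 1) ^ (2 * n * m)" by linarith
    then have "real (2 * card F) \<le> real (4 * (2 * K + 1) ^ (2 * n * m))"
      by (rule of_nat_mono)
    then have "2 * real (card F) \<le> 4 * real (2 * K + 1) ^ (2 * n * m)"
      by (simp only: of_nat_mult of_nat_power of_nat_numeral)
    also have "\<dots> = exp L"
      unfolding L_def exp_add exp_of_nat_mult by simp
    finally show ?thesis .
  qed
  have sq: "(\<Sum>z\<in>P. (f \<phi> z)\<^sup>2) \<le> s" if "\<phi> \<in> F" for \<phi>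
  proof -
    have ub: "unit_ball (t j) n (fst \<phi> j)" if "j < m" for j
      using \<open>\<phi> \<in> F\<close> that by (auto simp: F_def G'_def)
    have "(\<Sum>z\<in>P. (f \<phi> z)\<^sup>2) \<le> (\<Sum>z\<in>P. \<Prod>j<m. (cmod (fst \<phi> j (z j)))\<^sup>2)"
    proof (rule sum_mono)
      fix z
      have "\<bar>f \<phi> z\<bar> \<le> cmod (\<Prod>j<m. fst \<phi> j (z j))"
        by (simp add: f_def abs_Re_le_cmod abs_Im_le_cmod)
      then have "(f \<phi> z)\<^sup>2 \<le> (cmod (\<Prod>j<m. fst \<phi> j (z j)))\<^sup>2"
        by (metis abs_ge_zero power2_abs power_mono)
      then show "(f \<phi> z)\<^sup>2 \<le> (\<Prod>j<m. (cmod (fst \<phi> j (z j)))\<^sup>2)"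
        by (simp only: prod_norm[symmetric] prod_power_distrib)
    qed
    also have "\<dots> = (\<Prod>j<m. \<Sum>i<n. (cmod (fst \<phi> j i))\<^sup>2)"
      unfolding P_def by (rule prod_sum_PiE[symmetric]) auto
    also have "\<dots> \<le> (\<Prod>j<m. real n powr (1 - 2 * t j))"
      using ub t n by (intro prod_mono conjI sum_nonneg unit_ball_sum_squares_le) auto
    also have "\<dots> = s"
      using n by (simp add: s_def \<tau>_def sum_subtractf sum_distrib_left flip: powr_sum)
    finally show ?thesis .
  qed
  obtain \<epsilon> where \<epsilon>: "\<forall>z. \<bar>\<epsilon> z\<bar> = (1::real)"
    "\<forall>\<phi>\<in>F. \<bar>\<Sum>z\<in>P. \<epsilon> z * f \<phi> z\<bar> \<le> L / \<mu> + \<mu> * s / 2"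
    by (rule uniformly_small_signed_sums[where f = f and s = s, OF finP finF \<mu>0 _ card]) (use sq in auto)
  have ln_n: "ln (real n) \<ge> 0" using n by simp
  have bound: "L / \<mu> + \<mu> * s / 2 \<le> real n powr e * (4 + 4 * real m + 2 * (real m)\<^sup>2 * ln (real n))"
  proof -
    have l1: "ln (real (2 * K + 1)) \<le> 2 + real m * ln (real n)"
    proof -
      have "ln (real (2 * K + 1)) \<le> ln (3 * real K)" using K by simp
      also have "\<dots> = ln 3 + ln (real K)" using K by (simp add: ln_mult)
      also have "ln (real K) = real m * ln (real n)" using n by (simp add: K_def ln_realpow)
      also have "ln 3 \<le> (2::real)" using ln_le_minus_one[of "3::real"] by simp
      finally show ?thesis by simp
    qed
    have "L \<le> 3 * real n + real (2 * n * m) * (2 + real m * ln (real n))"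
      unfolding L_def using ln_le_minus_one[of "4::real"] n l1
      by (intro add_mono mult_left_mono) auto
    also have "\<dots> = real n * (3 + 4 * real m + 2 * (real m)\<^sup>2 * ln (real n))"
      by (simp add: power2_eq_square algebra_simps)
    finally have "L / \<mu> \<le> real n * (3 + 4 * real m + 2 * (real m)\<^sup>2 * ln (real n)) / \<mu>"
      using \<mu>0 by (intro divide_right_mono) auto
    also have "\<dots> = real n powr e * (3 + 4 * real m + 2 * (real m)\<^sup>2 * ln (real n))"
    proof -
      have "real n powr e * \<mu> = real n powr 1"
        unfolding \<mu>_def powr_add[symmetric] by (simp add: e_def field_simps)
      then have "real n / \<mu> = real n powr e" using \<mu>0 n by (simp add: field_simps)
      then show ?thesis by (metis times_divide_eq_left)
    qed
    finally have "L / \<mu> \<le> real n powr e * (3 + 4 * real m + 2 * (real m)\<^sup>2 * ln (real n))" .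
    moreover have "\<mu> * s = real n powr e"
      unfolding \<mu>_def s_def powr_add[symmetric] by (simp add: e_def field_simps)
    moreover have "real n powr e \<ge> 0" by simp
    ultimately show ?thesis by (simp only: ring_distribs)
  qed
  have ne1: "real n powr e \<ge> 1"
    using n ts by (intro ge_one_powr_ge_zero) (auto simp: e_def \<tau>_def)
  show ?thesis
  \<comment> \<open>The signs were chosen on extensional index functions, so a general
    \<open>h\<close> is first restricted to its \<open>m\<close> relevant coordinates.\<close>
  proof (rule that[of "\<lambda>h. \<epsilon> (restrict h {..<m})"])
    show "\<forall>h. \<bar>\<epsilon> (restrict h {..<m})\<bar> = 1" using \<epsilon>(1) by simp
    fix x :: "nat \<Rightarrow> nat \<Rightarrow> complex"
    assume x: "\<And>j. j < m \<Longrightarrow> unit_ball (t j) n (x j)"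
    have x1: "cmod (x j i) \<le> 1" if "j < m" "i < n" for j i
      using unit_ball_norm_le[OF x t(1)] that by blast
    have "\<exists>v. v \<in> complex_grid K \<and> cmod v \<le> cmod (x j i) \<and> cmod (x j i - v) \<le> 2 / real K"
      if "j < m" "i < n" for j i
      using complex_grid_approx[OF x1[OF that] K] by blast
    then obtain v where v: "\<And>j i. j < m \<Longrightarrow> i < n \<Longrightarrow> v j i \<in> complex_grid K \<and> cmod (v j i) \<le> cmod (x j i)
        \<and> cmod (x j i - v j i) \<le> 2 / real K"
      by metis
    define g where "g = (\<lambda>j\<in>{..<m}. \<lambda>i\<in>{..<n}. v j i)"
    have g: "g \<in> G'"
    proof -
      have "g \<in> G" unfolding G_def g_def using v by (intro restrict_PiE_iff[THEN iffD2] ballI) auto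
      moreover have "unit_ball (t j) n (g j)" if "j < m" for j
        using v that by (intro unit_ball_mono[OF x t(1)]) (auto simp: g_def)
      ultimately show ?thesis by (simp add: G'_def)
    qed
    let ?Sx = "\<Sum>z\<in>P. of_real (\<epsilon> z) * (\<Prod>j<m. x j (z j))"
    let ?Sg = "\<Sum>z\<in>P. of_real (\<epsilon> z) * (\<Prod>j<m. g j (z j))"
    have Sx: "msum n {..<m} (\<lambda>h. of_real (\<epsilon> (restrict h {..<m})) * (\<Prod>j<m. x j (h j))) idx = ?Sx"
      unfolding msum_def P_def
    proof (intro sum.cong refl arg_cong2[of _ _ _ _ "(*)"] arg_cong[of _ _ of_real] arg_cong[of _ _ \<epsilon>])
      fix z assume "z \<in> PiE {..<m} (\<lambda>_. {..<n})"
      then show "restrict (\<lambda>j. if j \<in> {..<m} then z j else idx j) {..<m} = z"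
        by (auto simp: fun_eq_iff restrict_def PiE_def extensional_def)
    qed simp
    have "cmod ?Sg \<le> \<bar>Re ?Sg\<bar> + \<bar>Im ?Sg\<bar>" by (rule cmod_le)
    also have "Re ?Sg = (\<Sum>z\<in>P. \<epsilon> z * f (g, True) z)" by (simp add: f_def)
    also have "Im ?Sg = (\<Sum>z\<in>P. \<epsilon> z * f (g, False) z)" by (simp add: f_def)
    also have "\<bar>\<Sum>z\<in>P. \<epsilon> z * f (g, True) z\<bar> + \<bar>\<Sum>z\<in>P. \<epsilon> z * f (g, False) z\<bar> \<le> 2 * (L / \<mu> + \<mu> * s / 2)"
      using \<epsilon>(2)[rule_format, of "(g, True)"] \<epsilon>(2)[rule_format, of "(g, False)"] g by (simp add: F_def)
    finally have Sg: "cmod ?Sg \<le> 2 * (L / \<mu> + \<mu> * s / 2)" .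
    have "cmod (?Sx - ?Sg) \<le> (\<Sum>z\<in>P. real m * (2 / real K))"
      unfolding sum_subtractf[symmetric]
    proof (intro order_trans[OF norm_sum] sum_mono)
      fix z assume "z \<in> P"
      then have z: "z j < n" if "j < m" for j using that by (auto simp: P_def)
      have "cmod (of_real (\<epsilon> z) * (\<Prod>j<m. x j (z j)) - of_real (\<epsilon> z) * (\<Prod>j<m. g j (z j)))
          = cmod ((\<Prod>j<m. x j (z j)) - (\<Prod>j<m. g j (z j)))"
        using \<epsilon>(1) by (simp add: norm_mult flip: right_diff_distrib)
      \<comment> \<open>Products of factors of modulus at most 1 differ by at most the sum of the
        differences of their factors.\<close>
      also have "\<dots> \<le> (\<Sum>j<m. cmod (x j (z j) - g j (z j)))"
      proof (rule norm_prod_diff)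
        fix j assume "j \<in> {..<m}"
        then have j: "j < m" by simp
        show "cmod (x j (z j)) \<le> 1" using x1 j z by blast
        then show "cmod (g j (z j)) \<le> 1" using v[OF j z[OF j]] j z[OF j] by (simp add: g_def)
      qed
      also have "\<dots> \<le> (\<Sum>j<m. 2 / real K)"
        using v z by (intro sum_mono) (auto simp: g_def)
      finally show "cmod (of_real (\<epsilon> z) * (\<Prod>j<m. x j (z j)) - of_real (\<epsilon> z) * (\<Prod>j<m. g j (z j)))
          \<le> real m * (2 / real K)" by simp
    qed
    also have "\<dots> = 2 * real m"
      using n by (simp add: P_def card_PiE K_def)
    finally have Sxg: "cmod (?Sx - ?Sg) \<le> 2 * real m" .
    have m_le: "2 * real m \<le> real n powr e * (2 * real m)"
      using mult_right_mono[OF ne1, of "2 * real m"] by simp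
    have "cmod ?Sx \<le> cmod ?Sg + cmod (?Sx - ?Sg)"
      by (rule norm_triangle_sub)
    also have "\<dots> \<le> 2 * (L / \<mu> + \<mu> * s / 2) + real n powr e * (2 * real m)"
      by (intro add_mono Sg order_trans[OF Sxg m_le])
    also have "\<dots> \<le> 2 * (real n powr e * (4 + 4 * real m + 2 * (real m)\<^sup>2 * ln (real n))) + real n powr e * (2 * real m)"
      using bound by (intro add_mono mult_left_mono) auto
    finally show "cmod (msum n {..<m} (\<lambda>h. of_real (\<epsilon> (restrict h {..<m})) * (\<Prod>j<m. x j (h j))) idx)
      \<le> real n powr ((real m + 1) / 2 - (\<Sum>j<m. t j)) * (8 + 10 * real m + 4 * (real m)\<^sup>2 * ln (real n))"
      unfolding Sx by (simp add: e_def \<tau>_def algebra_simps)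
  qed
qed

section \<open>Test forms and sharpness\<close>

lemma array_mixed_one:
  assumes b: "\<And>h. (\<forall>j<m. h j < n) \<Longrightarrow> b h = 1" and r: "\<And>j. j < m \<Longrightarrow> r j > 0" and n: "n \<ge> 1"
    and d: "d \<le> m" and idx: "\<forall>j<m. idx j < n"
  shows "array_mixed b n m r d idx = real n powr (\<Sum>j\<in>{m - d..<m}. 1 / r j)"
  using d idx
proof (induction d arbitrary: idx)
  case 0
  then show ?case using b n by simp
next
  case (Suc d)
  let ?j = "m - Suc d"
  have j: "?j < m" using Suc.prems by simp
  have IH: "array_mixed b n m r d (idx(?j := i)) = real n powr (\<Sum>j\<in>{m - d..<m}. 1 / r j)" if "i < n" for i
    using that Suc.prems by (intro Suc.IH) auto
  have "array_mixed b n m r (Suc d) idx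
      = (\<Sum>i<n. (real n powr (\<Sum>j\<in>{m - d..<m}. 1 / r j)) powr r ?j) powr (1 / r ?j)"
    by (simp add: IH)
  also have "\<dots> = real n powr (1 / r ?j + (\<Sum>j\<in>{m - d..<m}. 1 / r j))"
    using r[OF j] n by (simp add: powr_mult powr_powr powr_add)
  also have "1 / r ?j + (\<Sum>j\<in>{m - d..<m}. 1 / r j) = (\<Sum>j\<in>{m - Suc d..<m}. 1 / r j)"
  proof -
    have "{m - Suc d..<m} = insert ?j {m - d..<m}" using Suc.prems by auto
    then show ?thesis using Suc.prems by simp
  qed
  finally show ?case .
qed

lemma array_mixed_ge_term:
  assumes b: "\<And>h. b h \<ge> 0" and r: "\<And>j. j < m \<Longrightarrow> r j > 0" and n: "n \<ge> 1" and d: "d \<le> m"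
  shows "b (\<lambda>_. 0) \<le> array_mixed b n m r d (\<lambda>_. 0)"
  using d
proof (induction d)
  case (Suc d)
  let ?j = "m - Suc d"
  let ?A = "\<lambda>i. array_mixed b n m r d ((\<lambda>_. 0)(?j := i))"
  have j: "?j < m" using Suc.prems by simp
  have "b (\<lambda>_. 0) \<le> ?A 0" using Suc by (simp add: fun_upd_idem)
  also have "?A 0 = (?A 0 powr r ?j) powr (1 / r ?j)"
    using r[OF j] array_mixed_nonneg[OF b] by (simp add: powr_powr)
  also have "\<dots> \<le> (\<Sum>i<n. ?A i powr r ?j) powr (1 / r ?j)"
    using r[OF j] n by (intro powr_mono2 member_le_sum[of 0 "{..<n}" "\<lambda>i. ?A i powr r ?j"]) auto
  finally show ?case by simp
qed simp

lemma opnorm_le: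
  fixes T :: "(nat \<Rightarrow> nat \<Rightarrow> 'a::real_normed_field) \<Rightarrow> 'a"
  assumes n: "n \<ge> 1" and p: "\<forall>j<m. 1 \<le> p j"
    and le: "\<And>x. (\<And>j. j < m \<Longrightarrow> unit_ball (inv_ext (p j)) n (x j)) \<Longrightarrow> norm (T x) \<le> B"
  shows "opnorm n m p T \<le> B"
  unfolding opnorm_def
proof (rule cSup_least)
  have "(\<lambda>_ _. 0) \<in> tuples n m \<and> (\<forall>j<m. pnorm (p j) n ((\<lambda>_ _. 0 :: 'a) j) \<le> 1)"
    using n p by (auto simp: tuples_def supp_vec_def pnorm_le_one_iff unit_ball_def)
  then show "{norm (T x) |x. x \<in> tuples n m \<and> (\<forall>j<m. pnorm (p j) n (x j) \<le> 1)} \<noteq> {}" by blast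
next
  fix y assume "y \<in> {norm (T x) |x. x \<in> tuples n m \<and> (\<forall>j<m. pnorm (p j) n (x j) \<le> 1)}"
  then show "y \<le> B" using le n p by (auto simp: pnorm_le_one_iff)
qed

text \<open>The base index \<open>\<lambda>_. 0\<close> means that \<open>a\<close> is evaluated
  only at index functions vanishing from \<open>m\<close> on.\<close>

definition tensor_form :: "nat \<Rightarrow> nat \<Rightarrow> ((nat \<Rightarrow> nat) \<Rightarrow> 'a) \<Rightarrow> (nat \<Rightarrow> nat \<Rightarrow> 'a::real_normed_field) \<Rightarrow> 'a" where
  "tensor_form n m a x = msum n {..<m} (\<lambda>h. a h * (\<Prod>j<m. x j (h j))) (\<lambda>_. 0)"

lemma multilinear_form_tensor_form: "multilinear_form n m (tensor_form n m a)"
  unfolding multilinear_form_def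
proof (intro ballI allI impI)
  fix x :: "nat \<Rightarrow> nat \<Rightarrow> 'a" and j and u v :: "nat \<Rightarrow> 'a" and c d :: 'a
  assume j: "j < m"
  have "(\<Prod>i<m. (x(j := w)) i (h i)) = w (h j) * (\<Prod>i\<in>{..<m} - {j}. x i (h i))" for w and h :: "nat \<Rightarrow> nat"
  proof -
    have "(\<Prod>i<m. (x(j := w)) i (h i)) = (x(j := w)) j (h j) * (\<Prod>i\<in>{..<m} - {j}. (x(j := w)) i (h i))"
      using j by (intro prod.remove) auto
    also have "(\<Prod>i\<in>{..<m} - {j}. (x(j := w)) i (h i)) = (\<Prod>i\<in>{..<m} - {j}. x i (h i))"
      by (intro prod.cong) auto
    finally show ?thesis by simp
  qed
  then show "tensor_form n m a (x(j := (\<lambda>i. c * u i + d * v i)))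
      = c * tensor_form n m a (x(j := u)) + d * tensor_form n m a (x(j := v))"
    unfolding tensor_form_def msum_def sum_distrib_left sum.distrib[symmetric]
    by (intro sum.cong refl) (simp add: algebra_simps)
qed

lemma tensor_form_unit_tuple:
  assumes h: "\<forall>j<m. h j < n"
  shows "tensor_form n m a (unit_tuple m h) = a (\<lambda>j. if j < m then h j else 0)"
proof -
  let ?P = "PiE {..<m} (\<lambda>_. {..<n})"
  have fin: "finite ?P" by (intro finite_PiE) auto
  have in_P: "restrict h {..<m} \<in> ?P" using h by auto
  have "tensor_form n m a (unit_tuple m h)
      = (\<Sum>z\<in>?P. if z = restrict h {..<m} then a (\<lambda>j. if j < m then h j else 0) else 0)"
    unfolding tensor_form_def msum_def
  proof (intro sum.cong refl)
    fix z assume z: "z \<in> ?P"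
    show "a (\<lambda>j. if j \<in> {..<m} then z j else 0)
         * (\<Prod>j<m. unit_tuple m h j (if j \<in> {..<m} then z j else 0))
       = (if z = restrict h {..<m} then a (\<lambda>j. if j < m then h j else 0) else 0)"
    proof (cases "z = restrict h {..<m}")
      case True
      then have "(\<lambda>j. if j \<in> {..<m} then z j else 0) = (\<lambda>j. if j < m then h j else 0)" by auto
      moreover have "(\<Prod>j<m. unit_tuple m h j (if j \<in> {..<m} then z j else 0)) = (1 :: 'a)"
        using True by (intro prod.neutral) (auto simp: unit_tuple_def unit_vec_def)
      ultimately show ?thesis using True by simp
    next
      case False
      then obtain j where "j < m" "z j \<noteq> h j"
        using PiE_ext[OF z in_P] by auto
      then have "\<exists>j\<in>{..<m}. unit_tuple m h j (if j \<in> {..<m} then z j else 0) = (0 :: 'a)"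
        by (intro bexI[of _ j]) (auto simp: unit_tuple_def unit_vec_def)
      then have "(\<Prod>j<m. unit_tuple m h j (if j \<in> {..<m} then z j else 0)) = (0 :: 'a)"
        by (intro prod_zero) auto
      then show ?thesis using False by simp
    qed
  qed
  also have "\<dots> = a (\<lambda>j. if j < m then h j else 0)"
    using fin in_P by (simp add: sum.delta)
  finally show ?thesis .
qed

text \<open>After division by \<open>n powr \<delta>\<close> the left side tends to 0, so it is
  eventually below 1, whatever the signs of the constants.\<close>

lemma powr_not_bounded_by_ln:
  assumes "\<delta> > 0"
  obtains n :: nat where "n \<ge> 1" "C * (A + B * ln (real n)) < real n powr \<delta>"
proof -
  have "(\<lambda>n. C * (A * real n powr (- \<delta>) + B * (ln (real n) / real n powr \<delta>))) \<longlonglongrightarrow> C * (A * 0 + B * 0)"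
    using assms by (intro tendsto_intros lim_ln_over_power tendsto_neg_powr filterlim_real_sequentially) auto
  then have "\<forall>\<^sub>F n in sequentially. C * (A * real n powr (- \<delta>) + B * (ln (real n) / real n powr \<delta>)) < 1"
    by (intro order_tendstoD) auto
  then have "\<forall>\<^sub>F n in sequentially. n \<ge> 1 \<and> C * (A * real n powr (- \<delta>) + B * (ln (real n) / real n powr \<delta>)) < 1"
    using eventually_ge_at_top[of "1::nat"] by eventually_elim auto
  then obtain n :: nat where n: "n \<ge> 1" "C * (A * real n powr (- \<delta>) + B * (ln (real n) / real n powr \<delta>)) < 1"
    using eventually_happens'[OF sequentially_bot] by blast
  have pos: "real n powr \<delta> > 0" using n by simp
  have "C * (A * real n powr (- \<delta>) + B * (ln (real n) / real n powr \<delta>)) = C * (A + B * ln (real n)) / real n powr \<delta>"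
    by (simp add: powr_minus_divide flip: add_divide_distrib)
  then have "C * (A + B * ln (real n)) / real n powr \<delta> < 1" using n(2) by simp
  then show ?thesis using that[OF n(1)] pos by (simp add: pos_divide_less_eq)
qed

text \<open>The norm-preserving embedding \<open>\<iota>\<close> carries the unit balls into the
  complex ones, so the signed tensor built for complex vectors serves both scalar fields.\<close>

lemma exponent_optimal:
  fixes \<iota> :: "'a::real_normed_field \<Rightarrow> complex"
  assumes \<iota>: "linear \<iota>" "\<And>x y. \<iota> (x * y) = \<iota> x * \<iota> y" "\<iota> 1 = 1" "\<And>z. cmod (\<iota> z) = norm z"
    and m: "m > 0" and p: "\<forall>j<m. 1 \<le> p j" and ps: "(\<Sum>j<m. inv_ext (p j)) \<le> 1 / 2"
    and r: "\<forall>j<m. 1 \<le> r j \<and> r j \<le> 2"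
    and s: "s < max ((\<Sum>j<m. 1 / r j) - (real m + 1) / 2 + (\<Sum>j<m. inv_ext (p j))) 0"
    and D: "\<And>n T. n \<ge> 1 \<Longrightarrow> multilinear_form n m (T :: (nat \<Rightarrow> nat \<Rightarrow> 'a) \<Rightarrow> 'a) \<Longrightarrow>
        mixed_norm T n m r \<le> D * real n powr s * opnorm n m p T"
  shows False
proof -
  have p0: "\<forall>j<m. 0 \<le> inv_ext (p j)" using p inv_ext_nonneg by blast
  have r0: "r j > 0" if "j < m" for j using r that by force
  \<comment> \<open>The sign of \<open>D\<close> is unknown; with \<open>\<bar>D\<bar>\<close> an
    upper bound for the operator norm can be inserted.\<close>
  have D': "mixed_norm T n m r \<le> \<bar>D\<bar> * real n powr s * B"
    if "n \<ge> 1" "multilinear_form n m T" "opnorm n m p T \<le> B" for n B and T :: "(nat \<Rightarrow> nat \<Rightarrow> 'a) \<Rightarrow> 'a"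
  proof -
    have op0: "0 \<le> opnorm n m p T" using opnorm_nonneg that p p0 by blast
    have "mixed_norm T n m r \<le> D * real n powr s * opnorm n m p T" using D that by blast
    also have "\<dots> \<le> \<bar>D\<bar> * real n powr s * B"
      using op0 that(3) by (intro mult_mono) auto
    finally show ?thesis .
  qed
  define \<tau> where "\<tau> = (\<Sum>j<m. inv_ext (p j))"
  consider "s < 0" | "s < (\<Sum>j<m. 1 / r j) - (real m + 1) / 2 + \<tau>"
    using s by (auto simp: \<tau>_def less_max_iff_disj)
  then show False
  proof cases
    case 1
    obtain n :: nat where n: "n \<ge> 1" "\<bar>D\<bar> * (1 + 0 * ln (real n)) < real n powr (- s)"
      by (rule powr_not_bounded_by_ln[of "- s" "\<bar>D\<bar>" 1 0]) (use 1 in auto)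
    \<comment> \<open>The product of the first coordinates has norm at most 1 and mixed norm at
      least 1 for every \<open>n\<close>, which contradicts decay of
      \<open>n powr s\<close>.\<close>
    define a where "a h = (if h = (\<lambda>_. 0) then 1 else (0::'a))" for h :: "nat \<Rightarrow> nat"
    define T where "T = tensor_form n m a"
    have ml: "multilinear_form n m T" unfolding T_def by (rule multilinear_form_tensor_form)
    have T: "T x = (\<Prod>j<m. x j 0)" for x
    proof -
      have "T x = (\<Sum>z\<in>PiE {..<m} (\<lambda>_. {..<n}). if z = (\<lambda>j\<in>{..<m}. 0) then (\<Prod>j<m. x j 0) else 0)"
        unfolding T_def tensor_form_def msum_def
      proof (intro sum.cong refl)
        fix z assume z: "z \<in> PiE {..<m} (\<lambda>_. {..<n})"
        have "(\<lambda>j. if j \<in> {..<m} then z j else 0) = (\<lambda>_. 0) \<longleftrightarrow> z = (\<lambda>j\<in>{..<m}. 0)"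
          using z by (auto simp: fun_eq_iff PiE_def extensional_def restrict_def)
        then show "a (\<lambda>j. if j \<in> {..<m} then z j else 0) * (\<Prod>j<m. x j (if j \<in> {..<m} then z j else 0))
           = (if z = (\<lambda>j\<in>{..<m}. 0) then (\<Prod>j<m. x j 0) else 0)"
          by (simp add: a_def)
      qed
      also have "\<dots> = (\<Prod>j<m. x j 0)"
      proof -
        have "finite (PiE {..<m} (\<lambda>_. {..<n}))" by (intro finite_PiE) auto
        moreover have "(\<lambda>j\<in>{..<m}. 0) \<in> PiE {..<m} (\<lambda>_. {..<n})" using n(1) by auto
        ultimately show ?thesis by (simp add: sum.delta)
      qed
      finally show ?thesis .
    qed
    have "opnorm n m p T \<le> 1"
    proof (rule opnorm_le[OF n(1) p])
      fix x :: "nat \<Rightarrow> nat \<Rightarrow> 'a" assume "\<And>j. j < m \<Longrightarrow> unit_ball (inv_ext (p j)) n (x j)"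
      then have "norm (x j 0) \<le> 1" if "j < m" for j
        using unit_ball_norm_le that p0 n(1) by (metis less_le_trans zero_less_one)
      then show "norm (T x) \<le> 1"
        unfolding T prod_norm[symmetric] by (intro prod_le_1) auto
    qed
    then have "mixed_norm T n m r \<le> \<bar>D\<bar> * real n powr s * 1"
      using D'[OF n(1) ml] by blast
    moreover have "1 \<le> mixed_norm T n m r"
    proof -
      have "norm (T (unit_tuple m (\<lambda>_. 0))) \<le> mixed_norm T n m r"
        unfolding mixed_norm_def mixsum_eq_array_mixed
        by (rule array_mixed_ge_term[of "\<lambda>h. norm (T (unit_tuple m h))"]) (use r0 n in auto)
      moreover have "T (unit_tuple m (\<lambda>_. 0)) = 1"
        unfolding T by (intro prod.neutral) (simp add: unit_tuple_def unit_vec_def)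
      ultimately show ?thesis by simp
    qed
    ultimately have "1 \<le> \<bar>D\<bar> * real n powr s" by simp
    then have "real n powr (- s) \<le> \<bar>D\<bar> * real n powr s * real n powr (- s)"
      by (metis mult_1 mult_right_mono powr_ge_zero)
    also have "\<dots> = \<bar>D\<bar>" using n(1) by (simp add: mult.assoc flip: powr_add)
    finally show False using n(2) by simp
  next
    case 2
    define R where "R = (\<Sum>j<m. 1 / r j)"
    define A where "A = 8 + 10 * real m"
    define B where "B = 4 * (real m)\<^sup>2"
    \<comment> \<open>The exponent is positive: it is the power \<open>R\<close> of the mixed norm
      of a sign tensor, less the power \<open>(m + 1) / 2 - \<tau>\<close> of its operator norm and
      less \<open>s\<close>.\<close>
    obtain n :: nat where n: "n \<ge> 1"
      "\<bar>D\<bar> * (A + B * ln (real n)) < real n powr (R - (real m + 1) / 2 + \<tau> - s)"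
      by (rule powr_not_bounded_by_ln[of "R - (real m + 1) / 2 + \<tau> - s" "\<bar>D\<bar>" A B])
        (use 2 in \<open>auto simp: R_def\<close>)
    have t2: "inv_ext (p j) \<le> 1 / 2" if "j < m" for j
    proof -
      have "inv_ext (p j) \<le> (\<Sum>j<m. inv_ext (p j))"
        using that p0 by (intro member_le_sum) auto
      then show ?thesis using ps by simp
    qed
    obtain \<epsilon> :: "(nat \<Rightarrow> nat) \<Rightarrow> real" where \<epsilon>: "\<forall>h. \<bar>\<epsilon> h\<bar> = 1"
      and small: "\<And>x :: nat \<Rightarrow> nat \<Rightarrow> complex. (\<And>j. j < m \<Longrightarrow> unit_ball (inv_ext (p j)) n (x j)) \<Longrightarrow>
      cmod (msum n {..<m} (\<lambda>h. of_real (\<epsilon> h) * (\<Prod>j<m. x j (h j))) (\<lambda>_. 0))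
      \<le> real n powr ((real m + 1) / 2 - (\<Sum>j<m. inv_ext (p j))) * (8 + 10 * real m + 4 * (real m)\<^sup>2 * ln (real n))"
      by (rule exists_small_signed_tensor[of m "\<lambda>j. inv_ext (p j)" n "\<lambda>_. 0"]) (use p0 t2 ps n in auto)
    define T where "T = tensor_form n m (\<lambda>h. of_real (\<epsilon> h) :: 'a)"
    have ml: "multilinear_form n m T" unfolding T_def by (rule multilinear_form_tensor_form)
    have \<iota>_prod: "\<iota> (\<Prod>j\<in>J. f j) = (\<Prod>j\<in>J. \<iota> (f j))" for J :: "nat set" and f
      by (induction J rule: infinite_finite_induct) (simp_all add: \<iota>)
    have \<iota>_real: "\<iota> (of_real c) = of_real c" for c
      using linear_cmul[OF \<iota>(1), of c 1] \<iota>(3) by (simp add: of_real_def)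
    have op: "opnorm n m p T \<le> real n powr ((real m + 1) / 2 - \<tau>) * (A + B * ln (real n))"
    proof (rule opnorm_le[OF n(1) p])
      fix x :: "nat \<Rightarrow> nat \<Rightarrow> 'a" assume x: "\<And>j. j < m \<Longrightarrow> unit_ball (inv_ext (p j)) n (x j)"
      have "norm (T x) = cmod (\<iota> (T x))" by (simp add: \<iota>)
      also have "\<iota> (T x) = msum n {..<m} (\<lambda>h. of_real (\<epsilon> h) * (\<Prod>j<m. \<iota> (x j (h j)))) (\<lambda>_. 0)"
        unfolding T_def tensor_form_def msum_def by (simp add: linear_sum[OF \<iota>(1)] \<iota>(2) \<iota>_prod \<iota>_real)
      also have "cmod \<dots> \<le> real n powr ((real m + 1) / 2 - \<tau>) * (A + B * ln (real n))"
        unfolding \<tau>_def A_def B_def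
      proof (rule small)
        show "unit_ball (inv_ext (p j)) n (\<lambda>i. \<iota> (x j i))" if "j < m" for j
          using x[OF that] by (simp add: unit_ball_def \<iota>(4))
      qed
      finally show "norm (T x) \<le> real n powr ((real m + 1) / 2 - \<tau>) * (A + B * ln (real n))" .
    qed
    have "mixed_norm T n m r = real n powr (\<Sum>j\<in>{m - m..<m}. 1 / r j)"
      unfolding mixed_norm_def mixsum_eq_array_mixed
    proof (rule array_mixed_one)
      show "norm (T (unit_tuple m h)) = 1" if "\<forall>j<m. h j < n" for h
        unfolding T_def tensor_form_unit_tuple[OF that] using \<epsilon> by simp
    qed (use r0 n in auto)
    then have "real n powr R \<le> \<bar>D\<bar> * real n powr s * (real n powr ((real m + 1) / 2 - \<tau>) * (A + B * ln (real n)))"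
      using D'[OF n(1) ml op] by (simp add: R_def lessThan_atLeast0)
    also have "\<dots> = \<bar>D\<bar> * (A + B * ln (real n)) * real n powr (s + ((real m + 1) / 2 - \<tau>))"
      by (simp add: powr_add)
    also have "\<dots> < real n powr (R - (real m + 1) / 2 + \<tau> - s) * real n powr (s + ((real m + 1) / 2 - \<tau>))"
      using n by (intro mult_strict_right_mono) auto
    also have "\<dots> = real n powr R"
      unfolding powr_add[symmetric] by simp
    finally show False by simp
  qed
qed

section \<open>Real and complex scalars\<close>

theorem mainTheorem4:
  fixes m :: nat and p :: "nat \<Rightarrow> ereal" and r :: "nat \<Rightarrow> real"
  assumes "m \<ge> 2"
    and "\<forall>j<m. 1 \<le> p j"
    and "(\<Sum>j<m. inv_ext (p j)) \<le> 1/2"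
    and "\<forall>j<m. 1 \<le> r j \<and> r j \<le> 2"
  defines "E \<equiv> max ((\<Sum>j<m. 1 / r j) - (real m + 1) / 2 + (\<Sum>j<m. inv_ext (p j))) 0"
  shows
    "(\<exists>D\<ge>1. \<forall>n\<ge>1. \<forall>T :: (nat \<Rightarrow> nat \<Rightarrow> real) \<Rightarrow> real. multilinear_form n m T \<longrightarrow>
        mixed_norm T n m r \<le> D * real n powr E * opnorm n m p T)
   \<and> (\<forall>s<E. \<not> (\<exists>D. \<forall>n\<ge>1. \<forall>T :: (nat \<Rightarrow> nat \<Rightarrow> real) \<Rightarrow> real. multilinear_form n m T \<longrightarrow>
        mixed_norm T n m r \<le> D * real n powr s * opnorm n m p T))
   \<and> (\<exists>D\<ge>1. \<forall>n\<ge>1. \<forall>T :: (nat \<Rightarrow> nat \<Rightarrow> complex) \<Rightarrow> complex. multilinear_form n m T \<longrightarrow>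
        mixed_norm T n m r \<le> D * real n powr E * opnorm n m p T)
   \<and> (\<forall>s<E. \<not> (\<exists>D. \<forall>n\<ge>1. \<forall>T :: (nat \<Rightarrow> nat \<Rightarrow> complex) \<Rightarrow> complex. multilinear_form n m T \<longrightarrow>
        mixed_norm T n m r \<le> D * real n powr s * opnorm n m p T))"
proof (intro conjI allI impI)
  have m0: "m > 0" using assms(1) by simp
  have E: "E = max ((\<Sum>j<m. 1 / r j) - (real m + 1) / 2 + (\<Sum>j<m. inv_ext (p j))) 0"
    by (simp add: E_def)
  \<comment> \<open>The constant serves both fields: 9/5 for each of \<open>m - 1\<close> uses of
    Khinchine, and 2 for the two coordinate functionals.\<close>
  have D: "(1::real) \<le> 2 * (9 / 5) ^ (m - 1)"
  proof -
    have "(1::real) \<le> (9 / 5) ^ (m - 1)" by (rule one_le_power) simp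
    then show ?thesis by linarith
  qed
  show "\<exists>D\<ge>1. \<forall>n\<ge>1. \<forall>T :: (nat \<Rightarrow> nat \<Rightarrow> real) \<Rightarrow> real. multilinear_form n m T \<longrightarrow>
        mixed_norm T n m r \<le> D * real n powr E * opnorm n m p T"
    using D mixed_norm_le_opnorm[of "\<lambda>x::real. x" "\<lambda>x::real. x" m p r, OF _ _ _ _ _ m0 assms(2-4)]
    unfolding E by (intro exI[of _ "2 * (9 / 5) ^ (m - 1)"]) (simp add: linear_ident)
  show "\<exists>D\<ge>1. \<forall>n\<ge>1. \<forall>T :: (nat \<Rightarrow> nat \<Rightarrow> complex) \<Rightarrow> complex. multilinear_form n m T \<longrightarrow>
        mixed_norm T n m r \<le> D * real n powr E * opnorm n m p T"
    using D mixed_norm_le_opnorm[of Re Im m p r, OF _ _ _ _ _ m0 assms(2-4)]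
    unfolding E by (intro exI[of _ "2 * (9 / 5) ^ (m - 1)"])
      (simp add: bounded_linear.linear[OF bounded_linear_Re] bounded_linear.linear[OF bounded_linear_Im]
        abs_Re_le_cmod abs_Im_le_cmod cmod_power2)
  fix s assume s: "s < E"
  show "\<not> (\<exists>D. \<forall>n\<ge>1. \<forall>T :: (nat \<Rightarrow> nat \<Rightarrow> real) \<Rightarrow> real. multilinear_form n m T \<longrightarrow>
        mixed_norm T n m r \<le> D * real n powr s * opnorm n m p T)"
  proof
    assume "\<exists>D. \<forall>n\<ge>1. \<forall>T :: (nat \<Rightarrow> nat \<Rightarrow> real) \<Rightarrow> real. multilinear_form n m T \<longrightarrow>
        mixed_norm T n m r \<le> D * real n powr s * opnorm n m p T"
    then obtain D where D: "\<forall>n\<ge>1. \<forall>T :: (nat \<Rightarrow> nat \<Rightarrow> real) \<Rightarrow> real. multilinear_form n m T \<longrightarrow>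
        mixed_norm T n m r \<le> D * real n powr s * opnorm n m p T" ..
    show False
    proof (rule exponent_optimal[of "complex_of_real" m p r s D, OF _ _ _ _ m0 assms(2-4) s[unfolded E]])
      fix n and T :: "(nat \<Rightarrow> nat \<Rightarrow> real) \<Rightarrow> real"
      assume "n \<ge> 1" "multilinear_form n m T"
      then show "mixed_norm T n m r \<le> D * real n powr s * opnorm n m p T" using D by blast
    qed (simp_all add: bounded_linear.linear[OF bounded_linear_of_real])
  qed
  show "\<not> (\<exists>D. \<forall>n\<ge>1. \<forall>T :: (nat \<Rightarrow> nat \<Rightarrow> complex) \<Rightarrow> complex. multilinear_form n m T \<longrightarrow>
        mixed_norm T n m r \<le> D * real n powr s * opnorm n m p T)"
  proof
    assume "\<exists>D. \<forall>n\<ge>1. \<forall>T :: (nat \<Rightarrow> nat \<Rightarrow> complex) \<Rightarrow> complex. multilinear_form n m T \<longrightarrow>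
        mixed_norm T n m r \<le> D * real n powr s * opnorm n m p T"
    then obtain D where D: "\<forall>n\<ge>1. \<forall>T :: (nat \<Rightarrow> nat \<Rightarrow> complex) \<Rightarrow> complex. multilinear_form n m T \<longrightarrow>
        mixed_norm T n m r \<le> D * real n powr s * opnorm n m p T" ..
    show False
    proof (rule exponent_optimal[of "\<lambda>z. z" m p r s D, OF _ _ _ _ m0 assms(2-4) s[unfolded E]])
      fix n and T :: "(nat \<Rightarrow> nat \<Rightarrow> complex) \<Rightarrow> complex"
      assume "n \<ge> 1" "multilinear_form n m T"
      then show "mixed_norm T n m r \<le> D * real n powr s * opnorm n m p T" using D by blast
    qed (simp_all add: linear_ident)
  qed
qed

end
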